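(* Let $\phi:M\to\mathbb{C}^2$ be a Hamiltonian stationary, non totally geodesic, Lagrangian translating soliton for mean curvature flow. Then, up to dilations and rigid motions of $\mathbb{C}^2$, $\phi(M)$ is an open subset of $$\mathcal{M}=\{(z,w)\in\mathbb{C}^2 : w^2=2\,\mathrm{Re}z\;e^{-2i\,\mathrm{Im}z},\ \mathrm{Re}z\geq0\}.$$
   Context: On $\mathbb{C}^2\equiv\mathbb{R}^4$ use the Euclidean metric $\langle\cdot,\cdot\rangle=\mathrm{Re}(z_1\bar w_1+z_2\bar w_2)$, complex structure $J$ (multiplication by $i$), and Kähler form $\langle J\cdot,\cdot\rangle$. $M$ is a connected smooth surface. An immersion $\phi:M\to\mathbb{C}^2$ is Lagrangian if the Kähler form pulls back to $0$. If $M$ is oriented with area form $\omega_M$, the Lagrangian angle $\beta$ is defined (modulo $2\pi$) by $\phi^*(dz_1\wedge dz_2)=e^{i\beta}\omega_M$. $\phi$ is Hamiltonian stationary if $\beta$ is harmonic, $\Delta\beta=0$, with $\Delta$ the Laplacian of the induced metric. $\phi$ is a translating soliton for mean curvature flow if its mean curvature vector $H=\mathrm{trace}\,\sigma$ ($\sigma$ the second fundamental form) satisfies $H=\mathbf{e}^\perp$ (normal projection) for some nonzero constant vector $\mathbf{e}\in\mathbb{R}^4$, called the translating vector. *)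

theory Defs
  imports "HOL-Analysis.Analysis"
begin

section \<open>Smooth maps\<close>

primrec Ck_on :: "nat \<Rightarrow> ('a::euclidean_space \<Rightarrow> 'b::real_normed_vector) \<Rightarrow> 'a set \<Rightarrow> bool" where
  "Ck_on 0 f S \<longleftrightarrow> continuous_on S f"
| "Ck_on (Suc k) f S \<longleftrightarrow> (\<forall>x\<in>S. f differentiable (at x)) \<and>
     (\<forall>v. Ck_on k (\<lambda>x. frechet_derivative f (at x) v) S)"

text \<open>Only meaningful (and only used) for open \<open>S\<close>.\<close>
definition smooth_on :: "('a::euclidean_space \<Rightarrow> 'b::real_normed_vector) \<Rightarrow> 'a set \<Rightarrow> bool" where
  "smooth_on f S \<longleftrightarrow> (\<forall>k. Ck_on k f S)"

definition pd :: "2 \<Rightarrow> (real^2 \<Rightarrow> 'b::real_normed_vector) \<Rightarrow> real^2 \<Rightarrow> 'b" where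
  "pd i f u = frechet_derivative f (at u) (axis i 1)"


section \<open>Abstract smooth surfaces\<close>

text \<open>A chart is a pair of a domain \<open>U\<close> and a coordinate map \<open>x\<close>, of which only the
  values on \<open>U\<close> matter; the atlas need not be maximal.\<close>
type_synonym 'a chart = "'a set \<times> ('a \<Rightarrow> real^2)"

definition smooth_atlas :: "'a topology \<Rightarrow> 'a chart set \<Rightarrow> bool" where
  "smooth_atlas M \<A> \<longleftrightarrow>
     (\<Union>(U, x)\<in>\<A>. U) = topspace M \<and>
     (\<forall>(U, x)\<in>\<A>. openin M U \<and> open (x ` U) \<and>
        homeomorphic_map (subtopology M U) (top_of_set (x ` U)) x) \<and>
     (\<forall>(U, x)\<in>\<A>. \<forall>(V, y)\<in>\<A>. smooth_on (y \<circ> inv_into U x) (x ` (U \<inter> V)))"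

definition connected_smooth_surface :: "'a topology \<Rightarrow> 'a chart set \<Rightarrow> bool" where
  "connected_smooth_surface M \<A> \<longleftrightarrow>
     Hausdorff_space M \<and> second_countable M \<and> connected_space M \<and> smooth_atlas M \<A>"


section \<open>The complex Euclidean plane\<close>

text \<open>The library inner product on \<open>complex \<times> complex\<close> is
  \<open>Re (z1 * cnj w1 + z2 * cnj w2)\<close>, i.e. the Euclidean metric.\<close>

definition cJ :: "complex \<times> complex \<Rightarrow> complex \<times> complex" where
  "cJ p = (\<i> * fst p, \<i> * snd p)"

definition kaehler_form :: "complex \<times> complex \<Rightarrow> complex \<times> complex \<Rightarrow> real" where
  "kaehler_form v w = cJ v \<bullet> w"

text \<open>The complex 2-form \<open>dz1 \<and> dz2\<close>.\<close>
definition dz1_dz2 :: "complex \<times> complex \<Rightarrow> complex \<times> complex \<Rightarrow> complex" where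
  "dz1_dz2 v w = fst v * snd w - fst w * snd v"

text \<open>Isometries of the Euclidean metric that preserve the complex structure, i.e. unitary
  maps followed by translations.\<close>
definition rigid_motion :: "(complex \<times> complex \<Rightarrow> complex \<times> complex) \<Rightarrow> bool" where
  "rigid_motion R \<longleftrightarrow>
     (\<exists>T b. orthogonal_transformation T \<and> (\<forall>v. T (cJ v) = cJ (T v)) \<and> R = (\<lambda>p. T p + b))"

definition dilation :: "(complex \<times> complex \<Rightarrow> complex \<times> complex) \<Rightarrow> bool" where
  "dilation D \<longleftrightarrow> (\<exists>r>0. D = (\<lambda>p. r *\<^sub>R p))"


section \<open>Geometry of a parametrized surface\<close>

text \<open>In this section \<open>X\<close> is a local parametrization of an immersed surface.\<close>

definition tangent_plane :: "(real^2 \<Rightarrow> complex \<times> complex) \<Rightarrow> real^2 \<Rightarrow> (complex \<times> complex) set" where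
  "tangent_plane X u = range (frechet_derivative X (at u))"

definition normal_part ::
    "(real^2 \<Rightarrow> complex \<times> complex) \<Rightarrow> real^2 \<Rightarrow> complex \<times> complex \<Rightarrow> complex \<times> complex" where
  "normal_part X u v =
     (THE n. n \<in> orthogonal_comp (tangent_plane X u) \<and> v - n \<in> tangent_plane X u)"

definition gram :: "(real^2 \<Rightarrow> complex \<times> complex) \<Rightarrow> real^2 \<Rightarrow> real^2^2" where
  "gram X u = (\<chi> i j. pd i X u \<bullet> pd j X u)"

definition gram_inv :: "(real^2 \<Rightarrow> complex \<times> complex) \<Rightarrow> real^2 \<Rightarrow> real^2^2" where
  "gram_inv X u = matrix_inv (gram X u)"

definition area_density :: "(real^2 \<Rightarrow> complex \<times> complex) \<Rightarrow> real^2 \<Rightarrow> real" where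
  "area_density X u = sqrt (det (gram X u))"

text \<open>The components \<open>\<sigma>(\<partial>\<^sub>i, \<partial>\<^sub>j)\<close> of the second fundamental form.\<close>
definition second_ff ::
    "(real^2 \<Rightarrow> complex \<times> complex) \<Rightarrow> 2 \<Rightarrow> 2 \<Rightarrow> real^2 \<Rightarrow> complex \<times> complex" where
  "second_ff X i j u = normal_part X u (pd i (pd j X) u)"

definition mean_curvature :: "(real^2 \<Rightarrow> complex \<times> complex) \<Rightarrow> real^2 \<Rightarrow> complex \<times> complex" where
  "mean_curvature X u =
     (\<Sum>i\<in>UNIV. \<Sum>j\<in>UNIV. (gram_inv X u $ i $ j) *\<^sub>R second_ff X i j u)"

text \<open>The Laplace--Beltrami operator of the induced metric.\<close>
definition laplacian ::
    "(real^2 \<Rightarrow> complex \<times> complex) \<Rightarrow> (real^2 \<Rightarrow> real) \<Rightarrow> real^2 \<Rightarrow> real" where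
  "laplacian X f u =
     (\<Sum>i\<in>UNIV. pd i (\<lambda>v. area_density X v * (\<Sum>j\<in>UNIV. gram_inv X v $ i $ j * pd j f v)) u)
       / area_density X u"

text \<open>A smooth real-valued branch on \<open>W\<close> of the Lagrangian angle, with \<open>W\<close> oriented by the
  coordinates, so that the area form is \<open>area_density X\<close> times \<open>du1 \<and> du2\<close>.\<close>
definition lagrangian_angle_on ::
    "(real^2 \<Rightarrow> complex \<times> complex) \<Rightarrow> (real^2 \<Rightarrow> real) \<Rightarrow> (real^2) set \<Rightarrow> bool" where
  "lagrangian_angle_on X \<beta> W \<longleftrightarrow> smooth_on \<beta> W \<and>
     (\<forall>u\<in>W. dz1_dz2 (pd 1 X u) (pd 2 X u) = exp (\<i> * of_real (\<beta> u)) * of_real (area_density X u))"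


section \<open>Immersed surfaces\<close>

definition local_param :: "('a \<Rightarrow> complex \<times> complex) \<Rightarrow> 'a chart \<Rightarrow> real^2 \<Rightarrow> complex \<times> complex" where
  "local_param \<phi> c = \<phi> \<circ> inv_into (fst c) (snd c)"

definition coords :: "'a chart \<Rightarrow> (real^2) set" where
  "coords c = snd c ` fst c"

definition immersion :: "'a chart set \<Rightarrow> ('a \<Rightarrow> complex \<times> complex) \<Rightarrow> bool" where
  "immersion \<A> \<phi> \<longleftrightarrow> (\<forall>c\<in>\<A>. smooth_on (local_param \<phi> c) (coords c) \<and>
     (\<forall>u\<in>coords c. inj (frechet_derivative (local_param \<phi> c) (at u))))"

definition lagrangian :: "'a chart set \<Rightarrow> ('a \<Rightarrow> complex \<times> complex) \<Rightarrow> bool" where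
  "lagrangian \<A> \<phi> \<longleftrightarrow> (\<forall>c\<in>\<A>. \<forall>u\<in>coords c. \<forall>v w.
     kaehler_form (frechet_derivative (local_param \<phi> c) (at u) v)
                  (frechet_derivative (local_param \<phi> c) (at u) w) = 0)"

text \<open>The angle is only defined modulo \<open>2\<pi>\<close>, so its harmonicity refers to local real-valued
  branches. Reversing the orientation changes a branch by an odd multiple of \<open>\<pi>\<close>, so that using the
  orientations given by the charts is harmless and no global orientation is needed.\<close>
definition hamiltonian_stationary :: "'a chart set \<Rightarrow> ('a \<Rightarrow> complex \<times> complex) \<Rightarrow> bool" where
  "hamiltonian_stationary \<A> \<phi> \<longleftrightarrow> (\<forall>c\<in>\<A>. \<forall>u\<in>coords c. \<exists>W \<beta>.
     open W \<and> u \<in> W \<and> W \<subseteq> coords c \<and> lagrangian_angle_on (local_param \<phi> c) \<beta> W \<and>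
     (\<forall>v\<in>W. laplacian (local_param \<phi> c) \<beta> v = 0))"

definition totally_geodesic :: "'a chart set \<Rightarrow> ('a \<Rightarrow> complex \<times> complex) \<Rightarrow> bool" where
  "totally_geodesic \<A> \<phi> \<longleftrightarrow>
     (\<forall>c\<in>\<A>. \<forall>u\<in>coords c. \<forall>i j. second_ff (local_param \<phi> c) i j u = 0)"

definition translating_soliton :: "'a chart set \<Rightarrow> ('a \<Rightarrow> complex \<times> complex) \<Rightarrow> bool" where
  "translating_soliton \<A> \<phi> \<longleftrightarrow> (\<exists>e. e \<noteq> 0 \<and> (\<forall>c\<in>\<A>. \<forall>u\<in>coords c.
     mean_curvature (local_param \<phi> c) u = normal_part (local_param \<phi> c) u e))"

definition model_soliton :: "(complex \<times> complex) set" where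
  "model_soliton = {(z, w). w\<^sup>2 = of_real (2 * Re z) * exp (- 2 * \<i> * of_real (Im z)) \<and> Re z \<ge> 0}"

end

theory Submission
  imports Defs
begin

text \<open>Let \<open>e = T + N\<close> be the splitting of the translating vector into tangential and normal parts,
  \<open>k = |e|\<^sup>2\<close>, \<open>s = |N|\<^sup>2\<close>, and let \<open>f = \<langle>\<phi>, J e\<rangle>\<close>, \<open>g = \<langle>\<phi>, e\<rangle>\<close>. The equation \<open>H = N\<close> gives
  \<open>d\<beta> = - df\<close>, so Hamiltonian stationarity means \<open>\<langle>N, J e\<rangle> = 0\<close>, that is, \<open>T\<close> and \<open>J N\<close> are
  orthogonal tangent vectors. In an orthonormal tangent frame \<open>(p, r)\<close> with \<open>e = \<tau> p + \<nu> J r\<close>,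
  differentiating this relation and using \<open>H = N\<close> determines the whole second fundamental form.
  It follows that \<open>ds = - (2 / k) s\<^sup>2 dg\<close>, also where \<open>T = 0\<close> or \<open>N = 0\<close>. So \<open>s\<close> vanishes
  identically, which forces \<open>\<phi>\<close> to be totally geodesic, or nowhere. In the second case three
  quantities are constant on \<open>M\<close>: \<open>1 / s - 2 g / k\<close>, \<open>\<omega>(T) / s - \<omega>(\<phi>)\<close> with
  \<open>\<omega> = dz1_dz2 e\<close>, and \<open>exp (2 \<i> (\<beta> + f))\<close>. Together with
  \<open>\<omega>(T)\<^sup>2 = - s (k - s) exp (2 \<i> \<beta>)\<close> they give the equation of the model for
  \<open>(g + \<i> f, \<omega>(\<phi>))\<close> up to translation and a phase, and this pair is \<open>\<phi>\<close> in a unitary basis,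
  scaled by \<open>|e|\<close>. Openness is invariance of domain.\<close>

section \<open>Directional derivatives\<close>

definition dirD :: "('a::real_normed_vector \<Rightarrow> 'b::real_normed_vector) \<Rightarrow> 'a \<Rightarrow> 'a \<Rightarrow> 'b" where
  "dirD f v x = frechet_derivative f (at x) v"

lemma has_derivative_dirD:
  "f differentiable (at x) \<Longrightarrow> (f has_derivative (\<lambda>v. dirD f v x)) (at x)"
  unfolding dirD_def using frechet_derivative_works by blast

lemma dirD_eq: "(f has_derivative f') (at x) \<Longrightarrow> dirD f v x = f' v"
  unfolding dirD_def using frechet_derivative_at by metis

lemma linear_dirD: "f differentiable (at x) \<Longrightarrow> linear (\<lambda>v. dirD f v x)"
  using has_derivative_dirD has_derivative_linear by blast

lemma dirD_linear_simps:
  assumes "f differentiable (at x)"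
  shows "dirD f (v + w) x = dirD f v x + dirD f w x"
    and "dirD f (c *\<^sub>R v) x = c *\<^sub>R dirD f v x"
  using linear_add[OF linear_dirD[OF assms]] linear_scale[OF linear_dirD[OF assms]] by auto

lemma pd_eq_dirD: "pd i f = dirD f (axis i 1)"
  by (simp add: fun_eq_iff pd_def dirD_def)

lemma dirD_cong:
  assumes "open W" "x \<in> W" "\<And>y. y \<in> W \<Longrightarrow> f y = g y" "g differentiable (at x)"
  shows "dirD f v x = dirD g v x"
  unfolding dirD_def
  by (metis frechet_derivative_transform_within_open[OF assms(4,1,2)] assms(3))

lemma smooth_on_differentiable: "smooth_on f S \<Longrightarrow> x \<in> S \<Longrightarrow> f differentiable (at x)"
  unfolding smooth_on_def by (metis Ck_on.simps(2))

lemma smooth_on_dirD: "smooth_on f S \<Longrightarrow> smooth_on (dirD f v) S"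
  unfolding smooth_on_def dirD_def[abs_def] by (metis Ck_on.simps(2))

lemma smooth_on_continuous_on: "smooth_on f S \<Longrightarrow> continuous_on S f"
  unfolding smooth_on_def by (metis Ck_on.simps(1))

section \<open>Symmetry of second directional derivatives\<close>

lemma has_vector_derivative_line:
  assumes "f differentiable (at (p + t *\<^sub>R v))"
  shows "((\<lambda>t. f (p + t *\<^sub>R v)) has_vector_derivative dirD f v (p + t *\<^sub>R v)) (at t)"
proof -
  have 1: "((\<lambda>t. p + t *\<^sub>R v) has_derivative (\<lambda>h. h *\<^sub>R v)) (at t)"
    by (auto intro!: derivative_eq_intros)
  have "(f \<circ> (\<lambda>t. p + t *\<^sub>R v) has_derivative (\<lambda>w. dirD f w (p + t *\<^sub>R v)) \<circ> (\<lambda>h. h *\<^sub>R v)) (at t)"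
    using diff_chain_at[OF 1 has_derivative_dirD[OF assms]] .
  then show ?thesis
    by (simp add: has_vector_derivative_def o_def dirD_linear_simps(2)[OF assms])
qed

text \<open>The mean value theorem is applied twice, in direction \<open>v\<close> to the increment
  along \<open>w\<close> and then in direction \<open>w\<close>. The second difference is symmetric
  in \<open>v\<close> and \<open>w\<close>, which makes the two mixed derivatives
  comparable.\<close>

lemma second_difference:
  fixes f :: "'a::euclidean_space \<Rightarrow> real"
  assumes sub: "ball x r \<subseteq> S" and f: "smooth_on f S" and h: "0 < h" "h * (norm v + norm w) < r"
  shows "\<exists>p. dist x p \<le> h * (norm v + norm w) \<and>
    f (x + h *\<^sub>R v + h *\<^sub>R w) - f (x + h *\<^sub>R v) - f (x + h *\<^sub>R w) + f x = h\<^sup>2 * dirD (dirD f v) w p"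
proof -
  have d: "dist x (x + s *\<^sub>R v + t *\<^sub>R w) \<le> h * (norm v + norm w)"
    if "0 \<le> s" "s \<le> h" "0 \<le> t" "t \<le> h" for s t
  proof -
    have "dist x (x + s *\<^sub>R v + t *\<^sub>R w) = norm (s *\<^sub>R v + t *\<^sub>R w)"
      by (metis add.assoc add_diff_cancel_left' dist_commute dist_norm)
    also have "\<dots> \<le> s * norm v + t * norm w"
      using norm_triangle_ineq[of "s *\<^sub>R v" "t *\<^sub>R w"] that by simp
    also have "\<dots> \<le> h * norm v + h * norm w"
      using that by (intro add_mono mult_right_mono) auto
    finally show ?thesis by (simp add: algebra_simps)
  qed
  have inS: "x + s *\<^sub>R v + t *\<^sub>R w \<in> S"
    if "0 \<le> s" "s \<le> h" "0 \<le> t" "t \<le> h" for s t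
    using d[OF that] h sub by (auto simp: subset_eq)
  have der1: "((\<lambda>s. f (x + s *\<^sub>R v + t *\<^sub>R w)) has_real_derivative dirD f v (x + s *\<^sub>R v + t *\<^sub>R w)) (at s)"
    if "0 \<le> s" "s \<le> h" "0 \<le> t" "t \<le> h" for s t
    using has_vector_derivative_line[of f "x + t *\<^sub>R w" s v]
      smooth_on_differentiable[OF f inS[OF that]]
    by (simp add: has_real_derivative_iff_has_vector_derivative algebra_simps)
  define \<phi> where "\<phi> s = f (x + s *\<^sub>R v + h *\<^sub>R w) - f (x + s *\<^sub>R v + 0 *\<^sub>R w)" for s
  have "(\<phi> has_real_derivative dirD f v (x + s *\<^sub>R v + h *\<^sub>R w) - dirD f v (x + s *\<^sub>R v + 0 *\<^sub>R w)) (at s)"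
    if "0 \<le> s" "s \<le> h" for s
    unfolding \<phi>_def using that h by (intro DERIV_diff der1) auto
  then obtain \<xi> where \<xi>: "0 < \<xi>" "\<xi> < h"
    "\<phi> h - \<phi> 0 = (h - 0) * (dirD f v (x + \<xi> *\<^sub>R v + h *\<^sub>R w) - dirD f v (x + \<xi> *\<^sub>R v + 0 *\<^sub>R w))"
    using MVT2[OF h(1), of \<phi> "\<lambda>s. dirD f v (x + s *\<^sub>R v + h *\<^sub>R w) - dirD f v (x + s *\<^sub>R v + 0 *\<^sub>R w)"]
    by blast
  have "((\<lambda>t. dirD f v (x + \<xi> *\<^sub>R v + t *\<^sub>R w)) has_real_derivative
      dirD (dirD f v) w (x + \<xi> *\<^sub>R v + t *\<^sub>R w)) (at t)" if "0 \<le> t" "t \<le> h" for t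
    using has_vector_derivative_line[of "dirD f v" "x + \<xi> *\<^sub>R v" t w] \<xi>
      smooth_on_differentiable[OF smooth_on_dirD[OF f] inS] that
    by (simp add: has_real_derivative_iff_has_vector_derivative)
  then obtain \<eta> where \<eta>: "0 < \<eta>" "\<eta> < h"
    "dirD f v (x + \<xi> *\<^sub>R v + h *\<^sub>R w) - dirD f v (x + \<xi> *\<^sub>R v + 0 *\<^sub>R w)
      = (h - 0) * dirD (dirD f v) w (x + \<xi> *\<^sub>R v + \<eta> *\<^sub>R w)"
    using MVT2[OF h(1), of "\<lambda>t. dirD f v (x + \<xi> *\<^sub>R v + t *\<^sub>R w)"
        "\<lambda>t. dirD (dirD f v) w (x + \<xi> *\<^sub>R v + t *\<^sub>R w)"] by blast
  show ?thesis
    by (rule exI[of _ "x + \<xi> *\<^sub>R v + \<eta> *\<^sub>R w"])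
      (use \<xi> \<eta> d[of \<xi> \<eta>] in \<open>auto simp: \<phi>_def power2_eq_square algebra_simps\<close>)
qed

text \<open>Reading the same second difference in both orders yields points \<open>p\<close> and
  \<open>q\<close> arbitrarily close to \<open>x\<close> at which the two mixed derivatives agree;
  their continuity carries this over to \<open>x\<close>.\<close>

lemma dirD_commute_real:
  fixes f :: "'a::euclidean_space \<Rightarrow> real"
  assumes S: "open S" "x \<in> S" and f: "smooth_on f S"
  shows "dirD (dirD f v) w x = dirD (dirD f w) v x"
proof -
  obtain r where r: "r > 0" "ball x r \<subseteq> S" using S openE by blast
  let ?n = "norm v + norm w"
  have *: "\<exists>p q. dist x p < d \<and> dist x q < d \<and> dirD (dirD f v) w p = dirD (dirD f w) v q"
    if "d > 0" for d
  proof -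
    \<comment> \<open>Adding 1 keeps the denominator positive when \<open>v\<close> and
      \<open>w\<close> vanish, and the factor 2 makes the bounds strict.\<close>
    define h where "h = min r d / (2 * (?n + 1))"
    have np: "0 \<le> ?n" by simp
    have h: "0 < h" unfolding h_def using r that by (simp add: add_nonneg_pos)
    have "h * ?n \<le> h * (?n + 1)" using h by simp
    also have "\<dots> = min r d / 2"
    proof -
      have "m / (2 * c) * c = m / 2" if "c > 0" for m c :: real using that by simp
      then show ?thesis unfolding h_def using np by (metis add_nonneg_pos zero_less_one)
    qed
    also have "\<dots> < min r d" using r that by (simp add: min_def)
    finally have hm: "h * ?n < r" "h * ?n < d" by auto
    obtain p where p: "dist x p \<le> h * ?n" "f (x + h *\<^sub>R v + h *\<^sub>R w) - f (x + h *\<^sub>R v) - f (x + h *\<^sub>R w) + f x = h\<^sup>2 * dirD (dirD f v) w p"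
      using second_difference[OF r(2) f h hm(1)] by blast
    have hm': "h * (norm w + norm v) < r" using hm by (simp add: add.commute)
    obtain q where q: "dist x q \<le> h * (norm w + norm v)" "f (x + h *\<^sub>R w + h *\<^sub>R v) - f (x + h *\<^sub>R w) - f (x + h *\<^sub>R v) + f x = h\<^sup>2 * dirD (dirD f w) v q"
      using second_difference[OF r(2) f h hm'] by blast
    have "h\<^sup>2 * dirD (dirD f v) w p = h\<^sup>2 * dirD (dirD f w) v q"
      using p(2) q(2) by (simp add: algebra_simps)
    then have "dirD (dirD f v) w p = dirD (dirD f w) v q" using h by simp
    then show ?thesis using p(1) q(1) hm by (metis add.commute order_le_less_trans)
  qed
  have c: "isCont (dirD (dirD f v) w) x" "isCont (dirD (dirD f w) v) x"
    using smooth_on_continuous_on[OF smooth_on_dirD[OF smooth_on_dirD[OF f]], of v w]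
      smooth_on_continuous_on[OF smooth_on_dirD[OF smooth_on_dirD[OF f]], of w v] S(2)
    unfolding continuous_on_eq_continuous_at[OF S(1)] by simp_all
  show ?thesis
  proof (rule ccontr)
    assume ne: "dirD (dirD f v) w x \<noteq> dirD (dirD f w) v x"
    define \<epsilon> where "\<epsilon> = dist (dirD (dirD f v) w x) (dirD (dirD f w) v x)"
    have "\<epsilon> / 2 > 0" using ne unfolding \<epsilon>_def by simp
    obtain d1 where d1: "d1 > 0" "\<And>y. dist y x < d1 \<Longrightarrow> dist (dirD (dirD f v) w y) (dirD (dirD f v) w x) < \<epsilon>/2"
      using c(1)[unfolded continuous_at_eps_delta, rule_format, OF \<open>\<epsilon> / 2 > 0\<close>]
      by (auto simp: dist_commute dist_real_def)
    obtain d2 where d2: "d2 > 0" "\<And>y. dist y x < d2 \<Longrightarrow> dist (dirD (dirD f w) v y) (dirD (dirD f w) v x) < \<epsilon>/2"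
      using c(2)[unfolded continuous_at_eps_delta, rule_format, OF \<open>\<epsilon> / 2 > 0\<close>]
      by (auto simp: dist_commute dist_real_def)
    obtain p q where pq: "dist x p < min d1 d2" "dist x q < min d1 d2"
      "dirD (dirD f v) w p = dirD (dirD f w) v q" using *[of "min d1 d2"] d1 d2 by auto
    have "dist (dirD (dirD f v) w p) (dirD (dirD f v) w x) < \<epsilon>/2"
      using pq(1) by (intro d1(2)) (simp add: dist_commute)
    moreover have "dist (dirD (dirD f v) w p) (dirD (dirD f w) v x) < \<epsilon>/2"
      unfolding pq(3) using pq(2) by (intro d2(2)) (simp add: dist_commute)
    ultimately show False unfolding \<epsilon>_def using dist_triangle_half_r by blast
  qed
qed

lemma dirD_inner_left:
  assumes "f differentiable (at x)"
  shows "dirD (\<lambda>x. f x \<bullet> b) v x = dirD f v x \<bullet> b"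
  by (rule dirD_eq) (auto intro!: derivative_eq_intros has_derivative_dirD[OF assms])

text \<open>This reduces the symmetry of second derivatives to real-valued functions. The induction
  replaces a derivative by a function equal to it on \<open>S\<close> only, so it first needs
  \<open>cong\<close>: on an open set, \<open>Ck_on\<close> depends only on the values
  there.\<close>

lemma smooth_on_inner_const:
  fixes f :: "'a::euclidean_space \<Rightarrow> 'b::real_inner"
  assumes "open S" "smooth_on f S"
  shows "smooth_on (\<lambda>x. f x \<bullet> b) S"
proof -
  have cong: "Ck_on k g S" if "Ck_on k f S" "\<And>x. x \<in> S \<Longrightarrow> f x = g x" for k and f g :: "'a \<Rightarrow> real"
    using that
  proof (induction k arbitrary: f g)
    case 0
    then show ?case using continuous_on_eq by auto
  next
    case (Suc k)
    have d: "g differentiable (at x)" if "x \<in> S" for x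
    proof -
      have "f differentiable (at x)" using Suc.prems(1) that by simp
      then obtain f' where "(f has_derivative f') (at x)" unfolding differentiable_def by blast
      then have "(g has_derivative f') (at x)"
        by (rule has_derivative_transform_within_open[OF _ \<open>open S\<close> that Suc.prems(2)])
      then show ?thesis by (rule differentiableI)
    qed
    have eq: "frechet_derivative f (at x) v = frechet_derivative g (at x) v" if "x \<in> S" for x v
      using Suc.prems(1) frechet_derivative_transform_within_open[OF _ \<open>open S\<close> that Suc.prems(2)] that
      by simp
    have "Ck_on k (\<lambda>x. frechet_derivative g (at x) v) S" for v
      by (rule Suc.IH[OF _ eq]) (use Suc.prems(1) in simp)
    with d show ?case by simp
  qed
  have "Ck_on k f S \<Longrightarrow> Ck_on k (\<lambda>x. f x \<bullet> b) S" for k and f :: "'a \<Rightarrow> 'b"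
  proof (induction k arbitrary: f)
    case 0
    then show ?case by (simp add: continuous_on_inner)
  next
    case (Suc k)
    have "Ck_on k (\<lambda>x. frechet_derivative (\<lambda>x. f x \<bullet> b) (at x) v) S" for v
    proof (rule cong)
      show "Ck_on k (\<lambda>x. frechet_derivative f (at x) v \<bullet> b) S" using Suc by auto
      show "frechet_derivative f (at x) v \<bullet> b = frechet_derivative (\<lambda>x. f x \<bullet> b) (at x) v" if "x \<in> S" for x
        using dirD_inner_left[of f x b v] Suc.prems that by (auto simp: dirD_def)
    qed
    moreover have "(\<lambda>x. f x \<bullet> b) differentiable (at x)" if "x \<in> S" for x
      using Suc.prems that by simp
    ultimately show ?case by simp
  qed
  then show ?thesis using assms unfolding smooth_on_def by blast
qed

text \<open>Tested against a fixed vector \<open>b\<close>, the claim is the real-valued one for the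
  component along \<open>b\<close>.\<close>

lemma dirD_commute:
  fixes f :: "'a::euclidean_space \<Rightarrow> 'b::real_inner"
  assumes S: "open S" "x \<in> S" and f: "smooth_on f S"
  shows "dirD (dirD f v) w x = dirD (dirD f w) v x"
proof -
  have *: "dirD (dirD f v) w x \<bullet> b = dirD (dirD (\<lambda>x. f x \<bullet> b) v) w x" for b v w
  proof -
    have "dirD (dirD (\<lambda>x. f x \<bullet> b) v) w x = dirD (\<lambda>x. dirD f v x \<bullet> b) w x"
      by (intro dirD_cong[OF S] dirD_inner_left smooth_on_differentiable[OF f] differentiable_inner
          smooth_on_differentiable[OF smooth_on_dirD[OF f]] S differentiable_const)
    also have "\<dots> = dirD (dirD f v) w x \<bullet> b"
      by (intro dirD_inner_left smooth_on_differentiable[OF smooth_on_dirD[OF f]] S)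
    finally show ?thesis by simp
  qed
  have "dirD (dirD f v) w x \<bullet> b = dirD (dirD f w) v x \<bullet> b" for b
    unfolding * by (intro dirD_commute_real[OF S] smooth_on_inner_const[OF S(1) f])
  then show ?thesis by (metis inner_commute vector_eq_rdot)
qed

section \<open>Linear algebra of the complex plane\<close>

lemma linear_cJ: "linear cJ"
  by (auto simp: linear_iff cJ_def algebra_simps)

lemma cJ_simps [simp]:
  "cJ (x + y) = cJ x + cJ y" "cJ (x - y) = cJ x - cJ y" "cJ (c *\<^sub>R x) = c *\<^sub>R cJ x"
  "cJ (- x) = - cJ x" "cJ (cJ x) = - x" "cJ 0 = 0"
  by (auto simp: cJ_def prod_eq_iff algebra_simps)

lemma inner_cJ_cJ [simp]: "cJ x \<bullet> cJ y = x \<bullet> y"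
  by (simp add: cJ_def inner_prod_def inner_complex_def)

lemma inner_cJ_left: "cJ x \<bullet> y = - (x \<bullet> cJ y)"
  by (simp add: cJ_def inner_prod_def inner_complex_def)

lemma inner_cJ_self [simp]: "x \<bullet> cJ x = 0" "cJ x \<bullet> x = 0"
  by (simp_all add: cJ_def inner_prod_def inner_complex_def)

lemma bounded_linear_cJ: "bounded_linear cJ"
  using linear_cJ linear_conv_bounded_linear by blast

locale lagrangian_frame =
  fixes p r :: "complex \<times> complex"
  assumes pp: "p \<bullet> p = 1" and rr: "r \<bullet> r = 1" and pr: "p \<bullet> r = 0" and pJr: "p \<bullet> cJ r = 0"
begin

lemma frame_inner [simp]:
  "p \<bullet> p = 1" "r \<bullet> r = 1" "p \<bullet> r = 0" "r \<bullet> p = 0" "p \<bullet> cJ r = 0" "r \<bullet> cJ p = 0"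
  "cJ p \<bullet> r = 0" "cJ r \<bullet> p = 0"
proof -
  show 1: "p \<bullet> p = 1" "r \<bullet> r = 1" "p \<bullet> r = 0" "p \<bullet> cJ r = 0" by (fact pp rr pr pJr)+
  show "r \<bullet> p = 0" "cJ r \<bullet> p = 0" using 1 by (simp_all add: inner_commute)
  show "cJ p \<bullet> r = 0" using 1 by (simp add: inner_cJ_left)
  then show "r \<bullet> cJ p = 0" by (metis inner_commute)
qed

text \<open>The four vectors are nonzero and pairwise orthogonal in real dimension 4, so they span;
  the remainder \<open>?y\<close> is orthogonal to all of them and hence to itself.\<close>

lemma frame_expansion:
  "x = (x \<bullet> p) *\<^sub>R p + (x \<bullet> r) *\<^sub>R r + (x \<bullet> cJ p) *\<^sub>R cJ p + (x \<bullet> cJ r) *\<^sub>R cJ r"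
proof -
  let ?B = "{p, r, cJ p, cJ r}"
  have ne: "p \<noteq> r" "p \<noteq> cJ p" "p \<noteq> cJ r" "r \<noteq> cJ p" "r \<noteq> cJ r" "cJ p \<noteq> cJ r"
    using frame_inner inner_cJ_self inner_cJ_cJ by (metis zero_neq_one)+
  have "pairwise orthogonal ?B"
    by (auto simp: pairwise_def orthogonal_def)
  moreover have "0 \<notin> ?B" using frame_inner inner_cJ_cJ inner_zero_left by (metis insert_iff singletonD zero_neq_one)
  ultimately have "independent ?B" by (rule pairwise_orthogonal_independent)
  moreover have "card ?B = 4" using ne by simp
  ultimately have span: "UNIV \<subseteq> span ?B"
    by (intro card_ge_dim_independent) (auto simp: dim_UNIV)
  let ?y = "x - ((x \<bullet> p) *\<^sub>R p + (x \<bullet> r) *\<^sub>R r + (x \<bullet> cJ p) *\<^sub>R cJ p + (x \<bullet> cJ r) *\<^sub>R cJ r)"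
  have "orthogonal ?y b" if "b \<in> ?B" for b
    using that by (auto simp: orthogonal_def inner_diff_left inner_add_left)
  then have "orthogonal ?y ?y"
    using span by (intro orthogonal_to_span[of ?y ?B]) auto
  then show ?thesis by (simp add: orthogonal_def)
qed

end

lemma dz1_dz2_simps [simp]:
  "dz1_dz2 (x + y) z = dz1_dz2 x z + dz1_dz2 y z" "dz1_dz2 z (x + y) = dz1_dz2 z x + dz1_dz2 z y"
  "dz1_dz2 (x - y) z = dz1_dz2 x z - dz1_dz2 y z" "dz1_dz2 z (x - y) = dz1_dz2 z x - dz1_dz2 z y"
  "dz1_dz2 (c *\<^sub>R x) z = c *\<^sub>R dz1_dz2 x z" "dz1_dz2 z (c *\<^sub>R x) = c *\<^sub>R dz1_dz2 z x"
  "dz1_dz2 (- x) z = - dz1_dz2 x z" "dz1_dz2 z (- x) = - dz1_dz2 z x"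
  "dz1_dz2 (cJ x) z = \<i> * dz1_dz2 x z" "dz1_dz2 z (cJ x) = \<i> * dz1_dz2 z x" "dz1_dz2 x x = 0"
  "dz1_dz2 0 x = 0" "dz1_dz2 x 0 = 0"
  by (auto simp: dz1_dz2_def cJ_def algebra_simps scaleR_conv_of_real)

lemma dz1_dz2_commute: "dz1_dz2 x y = - dz1_dz2 y x"
  by (simp add: dz1_dz2_def algebra_simps)

lemma bounded_bilinear_dz1_dz2: "bounded_bilinear dz1_dz2"
proof -
  have "bilinear dz1_dz2"
    by (auto simp: bilinear_def linear_iff)
  then show ?thesis by (simp add: bilinear_conv_bounded_bilinear)
qed

text \<open>The standard Hermitian product, complex linear in \<open>x\<close>. Its imaginary part
  is minus the Kaehler form, so it is real on pairs of vectors of a Lagrangian plane.\<close>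

definition herm :: "complex \<times> complex \<Rightarrow> complex \<times> complex \<Rightarrow> complex" where
  "herm x y = of_real (x \<bullet> y) + \<i> * of_real (x \<bullet> cJ y)"

lemma herm_eq: "herm x y = fst x * cnj (fst y) + snd x * cnj (snd y)"
  by (simp add: herm_def cJ_def inner_prod_def inner_complex_def complex_eq_iff)

text \<open>The Cauchy-Binet formula for 2 by 2 complex matrices. On a Lagrangian plane the
  Hermitian products are real, and the squared modulus of \<open>dz1_dz2\<close> becomes a Gram
  determinant.\<close>

lemma Cauchy_Binet_dz1_dz2:
  "dz1_dz2 v w * cnj (dz1_dz2 x y) = herm v x * herm w y - herm v y * herm w x"
  by (simp add: herm_eq dz1_dz2_def algebra_simps)

lemma Re_Im_herm [simp]: "Re (herm x y) = x \<bullet> y" "Im (herm x y) = x \<bullet> cJ y"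
  by (simp_all add: herm_def)


section \<open>Lagrangian parametrizations\<close>

lemma dirD_inner:
  assumes "f differentiable (at x)" "g differentiable (at x)"
  shows "dirD (\<lambda>x. f x \<bullet> g x) v x = dirD f v x \<bullet> g x + f x \<bullet> dirD g v x"
  by (rule dirD_eq) (auto intro!: derivative_eq_intros has_derivative_dirD assms)

lemma dirD_bounded_linear:
  assumes "bounded_linear L" "f differentiable (at x)"
  shows "dirD (\<lambda>x. L (f x)) v x = L (dirD f v x)"
  by (rule dirD_eq) (rule bounded_linear.has_derivative[OF assms(1) has_derivative_dirD[OF assms(2)]])

lemma differentiable_bounded_linear:
  assumes "bounded_linear L" "f differentiable (at x)"
  shows "(\<lambda>x. L (f x)) differentiable (at x)"
  using bounded_linear.has_derivative[OF assms(1) has_derivative_dirD[OF assms(2)]] differentiableI by blast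

lemma dirD_const [simp]: "dirD (\<lambda>x. c) v x = 0"
  by (simp add: dirD_def)

lemma dirD_zero_on_open:
  assumes "open S" "x \<in> S" "\<And>y. y \<in> S \<Longrightarrow> f y = c"
  shows "dirD f v x = 0"
  using dirD_cong[OF assms(1,2), of f "\<lambda>_. c"] assms(3) by simp

text \<open>Two candidates for the normal part differ by a tangent vector that is orthogonal to both
  of them, hence to itself.\<close>

lemma normal_part_eqI:
  assumes lin: "linear (frechet_derivative X (at u))"
    and t: "t \<in> tangent_plane X u" and n: "\<And>y. y \<in> tangent_plane X u \<Longrightarrow> y \<bullet> (v - t) = 0"
  shows "normal_part X u v = v - t"
  unfolding normal_part_def
proof (rule the_equality)
  show "v - t \<in> (tangent_plane X u)\<^sup>\<bottom> \<and> v - (v - t) \<in> tangent_plane X u"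
    using t n by (auto simp: orthogonal_comp_def orthogonal_def)
next
  fix m assume m: "m \<in> (tangent_plane X u)\<^sup>\<bottom> \<and> v - m \<in> tangent_plane X u"
  have sub: "subspace (tangent_plane X u)"
    unfolding tangent_plane_def using lin by (simp add: linear_subspace_image)
  have "(v - t) - m \<in> tangent_plane X u"
    using subspace_diff[OF sub, of "v - m" t] m t by (simp add: algebra_simps)
  then have "((v - t) - m) \<bullet> (v - t) = 0" "((v - t) - m) \<bullet> m = 0"
    using n m by (auto simp: orthogonal_comp_def orthogonal_def)
  then have "((v - t) - m) \<bullet> ((v - t) - m) = 0" by (simp add: inner_diff_right)
  then show "m = v - t" by simp
qed

lemma real2_decomp: "(v::real^2) = (v $ 1) *\<^sub>R axis 1 1 + (v $ 2) *\<^sub>R axis 2 1"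
  by (simp add: vec_eq_iff forall_2 axis_def)

locale lagrangian_param =
  fixes X :: "real^2 \<Rightarrow> complex \<times> complex" and S :: "(real^2) set"
  assumes open_S: "open S" and smooth: "smooth_on X S"
    and inj: "u \<in> S \<Longrightarrow> inj (frechet_derivative X (at u))"
    and lag: "u \<in> S \<Longrightarrow> kaehler_form (dirD X v u) (dirD X w u) = 0"
begin

abbreviation D where "D v u \<equiv> dirD X v u"
abbreviation DD where "DD v w u \<equiv> dirD (dirD X v) w u"

text \<open>The cubic form \<open>\<langle>\<sigma>(v, w), J y\<rangle>\<close>; the tangential part of \<open>DD v w\<close> is killed by
  \<open>cJ (D y u)\<close>.\<close>
definition C where "C v w y u = DD v w u \<bullet> cJ (D y u)"

lemma diff_X: "u \<in> S \<Longrightarrow> X differentiable (at u)"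
  using smooth_on_differentiable smooth by blast

lemma diff_D: "u \<in> S \<Longrightarrow> dirD X v differentiable (at u)"
  using smooth_on_differentiable smooth_on_dirD smooth by blast

lemma diff_cJD: "u \<in> S \<Longrightarrow> (\<lambda>u. cJ (D v u)) differentiable (at u)"
  by (rule differentiable_bounded_linear[OF bounded_linear_cJ diff_D])

lemma D_linear:
  assumes "u \<in> S"
  shows "D (v + w) u = D v u + D w u" "D (c *\<^sub>R v) u = c *\<^sub>R D v u"
    "D (- v) u = - D v u" "D (v - w) u = D v u - D w u"
  using linear_add[OF linear_dirD[OF diff_X[OF assms]]] linear_scale[OF linear_dirD[OF diff_X[OF assms]]]
    linear_neg[OF linear_dirD[OF diff_X[OF assms]]] linear_diff[OF linear_dirD[OF diff_X[OF assms]]]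
  by simp_all

lemma D_0: "u \<in> S \<Longrightarrow> D 0 u = 0"
  using D_linear(2)[of u 0 0] by simp

lemma D_eq_0: "u \<in> S \<Longrightarrow> D v u = 0 \<Longrightarrow> v = 0"
  using injD[OF inj, of u v 0] D_0[of u] by (simp add: dirD_def)

lemma DD_commute: "u \<in> S \<Longrightarrow> DD v w u = DD w v u"
  using dirD_commute open_S smooth by blast

lemma DD_linear_right:
  assumes "u \<in> S"
  shows "DD y (v + w) u = DD y v u + DD y w u" "DD y (c *\<^sub>R v) u = c *\<^sub>R DD y v u"
  using dirD_linear_simps[OF diff_D[OF assms]] by auto

lemma DD_linear_left:
  assumes "u \<in> S"
  shows "DD (v + w) y u = DD v y u + DD w y u" "DD (c *\<^sub>R v) y u = c *\<^sub>R DD v y u"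
  using DD_linear_right[OF assms] DD_commute[OF assms] by metis+

lemma inner_D_cJ_D [simp]: "u \<in> S \<Longrightarrow> D v u \<bullet> cJ (D w u) = 0"
  using lag[of u v w] by (simp add: kaehler_form_def inner_cJ_left)

lemma inner_cJ_D_D [simp]: "u \<in> S \<Longrightarrow> cJ (D v u) \<bullet> D w u = 0"
  by (metis inner_D_cJ_D inner_commute)

lemma C_swap12: "u \<in> S \<Longrightarrow> C v w y u = C w v y u"
  unfolding C_def using DD_commute by metis

text \<open>This is the derivative of the Lagrangian condition
  \<open>D v u \<bullet> cJ (D y u) = 0\<close> in direction \<open>w\<close>. With
  \<open>C_swap12\<close> it makes the cubic form totally symmetric.\<close>

lemma C_swap13: 
  assumes "u \<in> S"
  shows "C v w y u = C y w v u"
proof -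
  have "dirD (\<lambda>u. D v u \<bullet> cJ (D y u)) w u = 0"
    by (rule dirD_zero_on_open[OF open_S assms]) simp
  moreover have "dirD (\<lambda>u. D v u \<bullet> cJ (D y u)) w u = DD v w u \<bullet> cJ (D y u) + D v u \<bullet> cJ (DD y w u)"
    using assms by (simp add: dirD_inner diff_D diff_cJD dirD_bounded_linear bounded_linear_cJ)
  moreover have "D v u \<bullet> cJ (DD y w u) = - C y w v u"
    unfolding C_def by (metis inner_cJ_left inner_commute)
  ultimately show ?thesis by (simp add: C_def)
qed

lemma C_linear:
  assumes "u \<in> S"
  shows "C (v + v') w y u = C v w y u + C v' w y u" "C (c *\<^sub>R v) w y u = c * C v w y u"
    "C v (w + w') y u = C v w y u + C v w' y u" "C v (c *\<^sub>R w) y u = c * C v w y u"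
    "C v w (y + y') u = C v w y u + C v w y' u" "C v w (c *\<^sub>R y) u = c * C v w y u"
  unfolding C_def using assms
  by (simp_all add: DD_linear_left DD_linear_right D_linear inner_add_left inner_add_right)

section \<open>First fundamental form and orthonormal frames\<close>

definition E where "E u = D (axis 1 1) u \<bullet> D (axis 1 1) u"
definition F where "F u = D (axis 1 1) u \<bullet> D (axis 2 1) u"
definition G where "G u = D (axis 2 1) u \<bullet> D (axis 2 1) u"
definition gdet where "gdet u = E u * G u - F u * F u"

lemma D_decomp: "u \<in> S \<Longrightarrow> D v u = (v $ 1) *\<^sub>R D (axis 1 1) u + (v $ 2) *\<^sub>R D (axis 2 1) u"
  by (subst real2_decomp[of v]) (simp add: D_linear)

lemma E_pos: "u \<in> S \<Longrightarrow> E u > 0"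
  unfolding E_def using D_eq_0[of u "axis 1 1"] by (auto simp: axis_eq_0_iff)

text \<open>The Gram-Schmidt vector \<open>?w\<close> is nonzero, and its image under the injective
  derivative has squared length \<open>E u * gdet u\<close>.\<close>

lemma gdet_pos:
  assumes u: "u \<in> S" shows "gdet u > 0"
proof -
  let ?w = "E u *\<^sub>R axis 2 1 - F u *\<^sub>R axis 1 1 :: real^2"
  have Dw: "D ?w u = E u *\<^sub>R D (axis 2 1) u - F u *\<^sub>R D (axis 1 1) u"
    by (simp add: D_linear[OF u])
  have "?w \<noteq> 0"
  proof
    assume "?w = 0"
    then have "?w $ 2 = 0" by simp
    then show False using E_pos[OF u] by (simp add: axis_def)
  qed
  then have "D ?w u \<bullet> D ?w u > 0" using D_eq_0[OF u, of ?w] by (metis inner_gt_zero_iff)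
  moreover have "D ?w u \<bullet> D ?w u = E u * gdet u"
    unfolding Dw by (simp add: inner_diff_left inner_diff_right gdet_def inner_commute
        E_def[symmetric] F_def[symmetric] G_def[symmetric] algebra_simps)
  ultimately show ?thesis using E_pos[OF u] by (simp add: zero_less_mult_iff)
qed

text \<open>Gram-Schmidt applied to the coordinate vectors, carried out in the parameter plane so
  that the frame consists of images of \<open>a\<close> and \<open>b\<close>.\<close>

lemma orthonormal_frame:
  assumes u: "u \<in> S"
  obtains a b where "D a u \<bullet> D a u = 1" "D b u \<bullet> D b u = 1" "D a u \<bullet> D b u = 0"
proof
  let ?a = "(1 / sqrt (E u)) *\<^sub>R axis 1 1 :: real^2"
  let ?b = "(E u / sqrt (E u * gdet u)) *\<^sub>R axis 2 1 + (- F u / sqrt (E u * gdet u)) *\<^sub>R axis 1 1 :: real^2"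
  note pos = E_pos[OF u] gdet_pos[OF u]
  have sq: "sqrt (E u) * sqrt (E u) = E u" "sqrt (E u * gdet u) * sqrt (E u * gdet u) = E u * gdet u"
    "sqrt (E u) \<noteq> 0" "sqrt (E u * gdet u) \<noteq> 0" "E u \<noteq> 0" "gdet u \<noteq> 0"
    using pos by auto
  show "D ?a u \<bullet> D ?a u = 1"
    using pos by (simp add: D_linear[OF u] E_def[symmetric] power2_eq_square[symmetric])
  show "D ?b u \<bullet> D ?b u = 1"
  proof -
    let ?q = "sqrt (E u * gdet u)"
    have "D ?b u \<bullet> D ?b u = (E u * (E u * G u - F u * F u)) / (?q * ?q)"
      by (simp add: D_linear[OF u] inner_add_left inner_add_right inner_diff_left inner_diff_right inner_commute
        E_def[symmetric] F_def[symmetric] G_def[symmetric] field_simps diff_divide_distrib del: real_sqrt_mult_self real_sqrt_mult)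
    also have "\<dots> = 1" unfolding sq(2) using sq by (simp add: gdet_def)
    finally show ?thesis .
  qed
  show "D ?a u \<bullet> D ?b u = 0"
    by (simp add: D_linear[OF u] inner_add_left inner_add_right inner_diff_left inner_diff_right inner_commute
        E_def[symmetric] F_def[symmetric] G_def[symmetric] field_simps)
qed

lemma frame_at:
  assumes "u \<in> S" "D a u \<bullet> D a u = 1" "D b u \<bullet> D b u = 1" "D a u \<bullet> D b u = 0"
  shows "lagrangian_frame (D a u) (D b u)"
  using assms by unfold_locales auto

lemma tangent_plane_eq: "tangent_plane X u = range (\<lambda>v. D v u)"
  by (simp add: tangent_plane_def dirD_def)

text \<open>The expansion of \<open>D v u\<close> in the frame has no \<open>cJ\<close> components,
  because the plane is Lagrangian, and injectivity of the derivative pulls it back to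
  \<open>v\<close>.\<close>

lemma frame_coords:
  assumes u: "u \<in> S" "D a u \<bullet> D a u = 1" "D b u \<bullet> D b u = 1" "D a u \<bullet> D b u = 0"
  shows "v = (D v u \<bullet> D a u) *\<^sub>R a + (D v u \<bullet> D b u) *\<^sub>R b"
proof -
  interpret lagrangian_frame "D a u" "D b u" using frame_at[OF u] .
  let ?w = "v - ((D v u \<bullet> D a u) *\<^sub>R a + (D v u \<bullet> D b u) *\<^sub>R b)"
  have "D ?w u = 0"
    using frame_expansion[of "D v u"] u(1) by (simp add: D_linear algebra_simps)
  then have "?w = 0" using D_eq_0 u by blast
  then show ?thesis by simp
qed

end

lemma matrix_inv_eqI:
  fixes A :: "'a::semiring_1^'n^'n"
  assumes "A ** B = mat 1" "B ** A = mat 1"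
  shows "matrix_inv A = B"
proof -
  have "A ** matrix_inv A = mat 1 \<and> matrix_inv A ** A = mat 1"
    unfolding matrix_inv_def by (rule someI[of _ B]) (use assms in auto)
  then have "B = B ** (A ** matrix_inv A)" by simp
  also have "\<dots> = matrix_inv A" by (simp add: matrix_mul_assoc assms)
  finally show ?thesis by simp
qed

section \<open>Inverse metric, tangential projection and mean curvature\<close>

context lagrangian_param
begin

lemma gram_nth: "gram X u $ 1 $ 1 = E u" "gram X u $ 1 $ 2 = F u" "gram X u $ 2 $ 1 = F u" "gram X u $ 2 $ 2 = G u"
  by (simp_all add: gram_def pd_eq_dirD E_def F_def G_def inner_commute)

lemma area_density_eq: "area_density X u = sqrt (gdet u)"
  by (simp add: area_density_def det_2 gram_nth gdet_def)

lemma gram_inv_nth: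
  assumes u: "u \<in> S"
  shows "gram_inv X u $ 1 $ 1 = G u / gdet u" "gram_inv X u $ 1 $ 2 = - F u / gdet u"
    "gram_inv X u $ 2 $ 1 = - F u / gdet u" "gram_inv X u $ 2 $ 2 = E u / gdet u"
proof -
  \<comment> \<open>\<open>K\<close> is the adjugate of the Gram matrix divided by its
    determinant.\<close>
  define K :: "real^2^2" where
    "K = (\<chi> i j. if i = 1 then (if j = 1 then G u / gdet u else - F u / gdet u)
      else (if j = 1 then - F u / gdet u else E u / gdet u))"
  have K: "K $ 1 $ 1 = G u / gdet u" "K $ 1 $ 2 = - F u / gdet u" "K $ 2 $ 1 = - F u / gdet u"
    "K $ 2 $ 2 = E u / gdet u" by (simp_all add: K_def)
  have g: "gdet u \<noteq> 0" using gdet_pos[OF u] by simp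
  have id: "E u * G u - F u * F u = gdet u" by (simp add: gdet_def)
  have 1: "G u * E u / gdet u - F u * F u / gdet u = 1" "E u * G u / gdet u - F u * F u / gdet u = 1"
    using g id by (simp_all add: diff_divide_distrib[symmetric] mult.commute)
  have "gram X u ** K = mat 1" "K ** gram X u = mat 1"
    using 1 by (simp_all add: vec_eq_iff forall_2 matrix_matrix_mult_def sum_2 mat_def gram_nth K)
  then have "gram_inv X u = K" unfolding gram_inv_def by (rule matrix_inv_eqI)
  with K show "gram_inv X u $ 1 $ 1 = G u / gdet u" "gram_inv X u $ 1 $ 2 = - F u / gdet u"
    "gram_inv X u $ 2 $ 1 = - F u / gdet u" "gram_inv X u $ 2 $ 2 = E u / gdet u" by auto
qed

lemma diff_EFG: 
  assumes "u \<in> S"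
  shows "E differentiable (at u)" "F differentiable (at u)" "G differentiable (at u)" "gdet differentiable (at u)"
proof -
  show 1: "E differentiable (at u)" "F differentiable (at u)" "G differentiable (at u)"
    unfolding E_def[abs_def] F_def[abs_def] G_def[abs_def]
    by (intro differentiable_inner diff_D assms)+
  show "gdet differentiable (at u)"
    unfolding gdet_def[abs_def] by (intro differentiable_diff differentiable_mult 1)
qed

lemma dirD_EFG:
  assumes "u \<in> S"
  shows "dirD E v u = 2 * (DD (axis 1 1) v u \<bullet> D (axis 1 1) u)"
    "dirD F v u = DD (axis 1 1) v u \<bullet> D (axis 2 1) u + D (axis 1 1) u \<bullet> DD (axis 2 1) v u"
    "dirD G v u = 2 * (DD (axis 2 1) v u \<bullet> D (axis 2 1) u)"
  unfolding E_def[abs_def] F_def[abs_def] G_def[abs_def]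
  using assms by (simp_all add: dirD_inner diff_D inner_commute)

lemma dirD_gdet:
  assumes "u \<in> S"
  shows "dirD gdet v u = dirD E v u * G u + E u * dirD G v u - 2 * F u * dirD F v u"
  unfolding gdet_def[abs_def]
  by (rule dirD_eq) (auto intro!: derivative_eq_intros has_derivative_dirD diff_EFG assms simp: algebra_simps)

lemma inner_D_EFG: "D (axis 1 1) u \<bullet> D (axis 1 1) u = E u" "D (axis 1 1) u \<bullet> D (axis 2 1) u = F u"
  "D (axis 2 1) u \<bullet> D (axis 1 1) u = F u" "D (axis 2 1) u \<bullet> D (axis 2 1) u = G u"
  by (simp_all add: E_def F_def G_def inner_commute)

text \<open>The tangential part of \<open>e\<close>.\<close>
definition T where
  "T e u = (1 / gdet u) *\<^sub>R ((G u * (e \<bullet> D (axis 1 1) u) - F u * (e \<bullet> D (axis 2 1) u)) *\<^sub>R D (axis 1 1) u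
     + (E u * (e \<bullet> D (axis 2 1) u) - F u * (e \<bullet> D (axis 1 1) u)) *\<^sub>R D (axis 2 1) u)"

lemma T_in_range:
  assumes u: "u \<in> S" obtains t where "T e u = D t u"
proof
  show "T e u = D ((1 / gdet u) *\<^sub>R ((G u * (e \<bullet> D (axis 1 1) u) - F u * (e \<bullet> D (axis 2 1) u)) *\<^sub>R axis 1 1
     + (E u * (e \<bullet> D (axis 2 1) u) - F u * (e \<bullet> D (axis 1 1) u)) *\<^sub>R axis 2 1)) u"
    by (simp add: T_def D_linear[OF u])
qed

lemma T_cJ: "u \<in> S \<Longrightarrow> T e u \<bullet> cJ (D v u) = 0"
  by (metis T_in_range inner_D_cJ_D)

text \<open>The coefficients in \<open>T\<close> solve the Gram system for the products with the two
  coordinate vectors.\<close>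

lemma T_inner:
  assumes u: "u \<in> S" shows "T e u \<bullet> D v u = e \<bullet> D v u"
proof -
  have g: "gdet u \<noteq> 0" using gdet_pos[OF u] by simp
  have 1: "gdet u * (T e u \<bullet> D (axis 1 1) u) = gdet u * (e \<bullet> D (axis 1 1) u)"
    "gdet u * (T e u \<bullet> D (axis 2 1) u) = gdet u * (e \<bullet> D (axis 2 1) u)"
    using g by (simp_all add: T_def inner_add_left inner_D_EFG) (simp_all add: gdet_def algebra_simps)
  show ?thesis unfolding D_decomp[OF u, of v] using 1 g by (simp add: inner_add_right)
qed

lemma diff_T: "u \<in> S \<Longrightarrow> T e differentiable (at u)"
  unfolding T_def[abs_def] using gdet_pos[of u]
  by (intro differentiable_scaleR differentiable_add differentiable_diff differentiable_mult diff_D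
      diff_EFG differentiable_inner differentiable_divide differentiable_const) auto

lemma normal_part_eq:
  assumes u: "u \<in> S" shows "normal_part X u e = e - T e u"
proof (rule normal_part_eqI)
  show "linear (frechet_derivative X (at u))"
    using linear_dirD[OF diff_X[OF u]] by (simp add: dirD_def)
  show "T e u \<in> tangent_plane X u" unfolding tangent_plane_eq by (metis T_in_range u rangeI)
  show "y \<bullet> (e - T e u) = 0" if y: "y \<in> tangent_plane X u" for y
  proof -
    obtain v where "y = D v u" using y unfolding tangent_plane_eq by blast
    then show ?thesis using T_inner[OF u, of e v] by (simp add: inner_diff_right inner_commute)
  qed
qed

lemma normal_part_cJ: "u \<in> S \<Longrightarrow> normal_part X u e \<bullet> cJ (D v u) = e \<bullet> cJ (D v u)"
  by (simp add: normal_part_eq inner_diff_left T_cJ)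

text \<open>Pairing with \<open>cJ (D v u)\<close> does not see tangential parts, so the projections
  in \<open>second_ff\<close> disappear and the mean curvature becomes a trace of the cubic form
  \<open>C\<close>.\<close>

lemma mean_curvature_cJ:
  assumes u: "u \<in> S"
  shows "gdet u * (mean_curvature X u \<bullet> cJ (D v u)) = G u * C (axis 1 1) (axis 1 1) v u
    - 2 * F u * C (axis 1 1) (axis 2 1) v u + E u * C (axis 2 1) (axis 2 1) v u"
proof -
  have g: "gdet u \<noteq> 0" using gdet_pos[OF u] by simp
  have s: "second_ff X i j u \<bullet> cJ (D v u) = C (axis j 1) (axis i 1) v u" for i j
    by (simp add: second_ff_def normal_part_cJ[OF u] pd_eq_dirD C_def)
  show ?thesis
    using g C_swap12[OF u, of "axis 2 1" "axis 1 1" v]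
    by (simp add: mean_curvature_def sum_2 inner_add_left s gram_inv_nth[OF u] algebra_simps)
qed

text \<open>For a Lagrangian surface \<open>cJ\<close> carries the tangent plane onto the normal
  plane, so every normal vector is \<open>cJ\<close> of a tangent vector.\<close>

lemma D_cJ_decomp:
  assumes u: "u \<in> S" obtains t n where "e = D t u + cJ (D n u)"
proof -
  obtain a b where ab: "D a u \<bullet> D a u = 1" "D b u \<bullet> D b u = 1" "D a u \<bullet> D b u = 0"
    using orthonormal_frame[OF u] .
  interpret lagrangian_frame "D a u" "D b u" using frame_at[OF u ab] .
  have "e = D ((e \<bullet> D a u) *\<^sub>R a + (e \<bullet> D b u) *\<^sub>R b) u + cJ (D ((e \<bullet> cJ (D a u)) *\<^sub>R a + (e \<bullet> cJ (D b u)) *\<^sub>R b) u)"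
    using frame_expansion[of e] by (simp add: D_linear[OF u] add.assoc)
  then show thesis by (rule that)
qed

text \<open>The trace does not depend on the basis: the matrix expressing the coordinate vectors in
  the frame has squared determinant \<open>gdet u\<close>, and both sides agree after multiplication
  by it.\<close>

lemma C_trace:
  assumes u: "u \<in> S" "D a u \<bullet> D a u = 1" "D b u \<bullet> D b u = 1" "D a u \<bullet> D b u = 0"
  shows "C a a v u + C b b v u = mean_curvature X u \<bullet> cJ (D v u)"
proof -
  define \<alpha> \<beta> \<gamma> \<delta> where abcd: "\<alpha> = D (axis 1 1) u \<bullet> D a u" "\<beta> = D (axis 1 1) u \<bullet> D b u"
    "\<gamma> = D (axis 2 1) u \<bullet> D a u" "\<delta> = D (axis 2 1) u \<bullet> D b u"
  have e1: "axis 1 1 = \<alpha> *\<^sub>R a + \<beta> *\<^sub>R b" and e2: "axis 2 1 = \<gamma> *\<^sub>R a + \<delta> *\<^sub>R b"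
    unfolding abcd using frame_coords[OF u] by blast+
  have ba: "D b u \<bullet> D a u = 0" using u by (simp add: inner_commute)
  have EFG: "E u = \<alpha>*\<alpha> + \<beta>*\<beta>" "F u = \<alpha>*\<gamma> + \<beta>*\<delta>" "G u = \<gamma>*\<gamma> + \<delta>*\<delta>"
    unfolding E_def F_def G_def e1 e2 using u ba
    by (simp_all add: D_linear[OF u(1)] inner_add_left inner_add_right)
  have g: "gdet u = (\<alpha>*\<delta> - \<beta>*\<gamma>)^2"
    unfolding gdet_def EFG by (simp add: power2_eq_square algebra_simps)
  have ba': "C b a v u = C a b v u" using C_swap12[OF u(1)] .
  have "gdet u * (mean_curvature X u \<bullet> cJ (D v u)) = gdet u * (C a a v u + C b b v u)"
    unfolding mean_curvature_cJ[OF u(1)] unfolding e1 e2 C_linear[OF u(1)] EFG g ba'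
    by (simp add: power2_eq_square algebra_simps)
  then show ?thesis using gdet_pos[OF u(1)] by simp
qed

end

section \<open>Translating solitons and the Lagrangian angle\<close>

locale soliton_param = lagrangian_param +
  fixes e :: "complex \<times> complex"
  assumes e_nz: "e \<noteq> 0"
    and soliton: "u \<in> S \<Longrightarrow> mean_curvature X u = normal_part X u e"
    and angle: "u \<in> S \<Longrightarrow> \<exists>W \<beta>. open W \<and> u \<in> W \<and> W \<subseteq> S \<and> lagrangian_angle_on X \<beta> W \<and>
      (\<forall>v\<in>W. laplacian X \<beta> v = 0)"
begin

lemma soliton_C:
  "u \<in> S \<Longrightarrow> G u * C (axis 1 1) (axis 1 1) v u - 2 * F u * C (axis 1 1) (axis 2 1) v u
    + E u * C (axis 2 1) (axis 2 1) v u = gdet u * (e \<bullet> cJ (D v u))"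
  using mean_curvature_cJ normal_part_cJ soliton by metis

lemma soliton_trace:
  assumes "u \<in> S" "D a u \<bullet> D a u = 1" "D b u \<bullet> D b u = 1" "D a u \<bullet> D b u = 0"
  shows "C a a v u + C b b v u = e \<bullet> cJ (D v u)"
  using C_trace[OF assms] soliton[OF assms(1)] normal_part_cJ[OF assms(1)] by metis

abbreviation \<Omega> where "\<Omega> u \<equiv> dz1_dz2 (D (axis 1 1) u) (D (axis 2 1) u)"

lemma Omega_norm: "u \<in> S \<Longrightarrow> \<Omega> u * cnj (\<Omega> u) = of_real (gdet u)"
  unfolding Cauchy_Binet_dz1_dz2 herm_def
  by (simp add: inner_D_EFG gdet_def)

definition dOmega where "dOmega v u = dz1_dz2 (DD (axis 1 1) v u) (D (axis 2 1) u)
    + dz1_dz2 (D (axis 1 1) u) (DD (axis 2 1) v u)"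

lemma has_derivative_Omega:
  assumes "u \<in> S" shows "(\<Omega> has_derivative (\<lambda>v. dOmega v u)) (at u)"
  unfolding dOmega_def
  using bounded_bilinear.FDERIV[OF bounded_bilinear_dz1_dz2 has_derivative_dirD[OF diff_D[OF assms]]
      has_derivative_dirD[OF diff_D[OF assms]]]
  by (simp add: add.commute)

text \<open>As \<open>\<Omega>\<close> has the Lagrangian angle as argument and squared modulus
  \<open>gdet\<close>, the left-hand side is \<open>gdet\<close> times the derivative of the angle.
  By Cauchy-Binet it collects only values of \<open>C\<close>, and these form the trace in
  \<open>soliton_C\<close>.\<close>

lemma Im_dOmega:
  assumes u: "u \<in> S" shows "Im (dOmega v u * cnj (\<Omega> u)) = gdet u * (e \<bullet> cJ (D v u))"
proof -
  have *: "C (axis 1 1) v (axis 1 1) u = C (axis 1 1) (axis 1 1) v u"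
    "C (axis 2 1) v (axis 1 1) u = C (axis 1 1) (axis 2 1) v u"
    "C (axis 1 1) v (axis 2 1) u = C (axis 1 1) (axis 2 1) v u"
    "C (axis 2 1) v (axis 2 1) u = C (axis 2 1) (axis 2 1) v u"
    using C_swap12[OF u] C_swap13[OF u] by metis+
  have herm_D: "herm (D x u) (D y u) = of_real (D x u \<bullet> D y u)" for x y
    by (simp add: herm_def u)
  show ?thesis
    unfolding soliton_C[OF u, symmetric] dOmega_def distrib_right Cauchy_Binet_dz1_dz2 herm_D inner_D_EFG
    using * by (simp add: C_def[symmetric] algebra_simps)
qed

text \<open>When \<open>\<Omega>\<close> is differentiated in polar form, the change of its modulus
  contributes only to the real part of \<open>dOmega v u * cnj (\<Omega> u)\<close>; the imaginary
  part is compared with \<open>Im_dOmega\<close>.\<close>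

lemma angle_deriv:
  assumes W: "open W" "W \<subseteq> S" "u \<in> W" and ang: "lagrangian_angle_on X \<beta> W"
  shows "dirD \<beta> v u = e \<bullet> cJ (D v u)"
proof -
  have u: "u \<in> S" using W by blast
  have beta: "\<beta> differentiable (at u)"
    using ang W(3) smooth_on_differentiable unfolding lagrangian_angle_on_def by blast
  have eq: "\<Omega> x = exp (\<i> * of_real (\<beta> x)) * of_real (sqrt (gdet x))" if "x \<in> W" for x
    using ang that unfolding lagrangian_angle_on_def pd_eq_dirD area_density_eq by blast
  obtain s' where s': "((\<lambda>x. sqrt (gdet x)) has_derivative s') (at u)"
    using has_derivative_real_sqrt[OF gdet_pos[OF u] has_derivative_dirD[OF diff_EFG(4)[OF u]]] by blast
  let ?ex = "exp (\<i> * of_real (\<beta> u))"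
  have "((\<lambda>x. \<i> * of_real (\<beta> x)) has_derivative (\<lambda>v. \<i> * of_real (dirD \<beta> v u))) (at u)"
    by (auto intro!: derivative_eq_intros has_derivative_dirD[OF beta])
  from has_derivative_compose[OF this DERIV_exp[unfolded has_field_derivative_def]]
  have ex: "((\<lambda>x. exp (\<i> * of_real (\<beta> x))) has_derivative (\<lambda>v. ?ex * (\<i> * of_real (dirD \<beta> v u)))) (at u)" .
  have "((\<lambda>x. exp (\<i> * of_real (\<beta> x)) * of_real (sqrt (gdet x))) has_derivative
     (\<lambda>v. ?ex * of_real (s' v) + (\<i> * of_real (dirD \<beta> v u)) * ?ex * of_real (sqrt (gdet u)))) (at u)"
    using has_derivative_mult[OF ex has_derivative_of_real[OF s']] by (simp add: algebra_simps)
  then have "(\<Omega> has_derivative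
     (\<lambda>v. ?ex * of_real (s' v) + (\<i> * of_real (dirD \<beta> v u)) * ?ex * of_real (sqrt (gdet u)))) (at u)"
    by (rule has_derivative_transform_within_open[OF _ W(1,3) eq[symmetric]])
  from fun_cong[OF has_derivative_unique[OF has_derivative_Omega[OF u] this], of v]
  have d: "dOmega v u = ?ex * of_real (s' v) + (\<i> * of_real (dirD \<beta> v u)) * ?ex * of_real (sqrt (gdet u))" .
  have unit: "?ex * cnj ?ex = 1"
    by (metis complex_norm_square norm_exp_i_times of_real_1 power_one)
  have "dOmega v u * cnj (\<Omega> u) = (?ex * cnj ?ex) *
     ((of_real (s' v) + \<i> * of_real (dirD \<beta> v u) * of_real (sqrt (gdet u))) * of_real (sqrt (gdet u)))"
    unfolding d eq[OF W(3)] by (simp add: algebra_simps)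
  then have "Im (dOmega v u * cnj (\<Omega> u)) = dirD \<beta> v u * (sqrt (gdet u) * sqrt (gdet u))"
    unfolding unit by simp
  also have "\<dots> = dirD \<beta> v u * gdet u" using gdet_pos[OF u] by simp
  finally show ?thesis using Im_dOmega[OF u, of v] gdet_pos[OF u] by simp
qed

text \<open>The Laplacian is a divergence of terms of this shape. Multiplying by the cube of
  \<open>sqrt (h u)\<close> clears the roots and leaves a polynomial identity.\<close>

lemma dirD_div_sqrt:
  fixes f h :: "real^2 \<Rightarrow> real"
  assumes "f differentiable (at u)" "h differentiable (at u)" "h u > 0"
  shows "dirD (\<lambda>u. f u / sqrt (h u)) v u * (sqrt (h u) * h u) = dirD f v u * h u - f u * dirD h v u / 2"
proof -
  have "dirD (\<lambda>u. f u / sqrt (h u)) v u =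
    (dirD f v u * sqrt (h u) - f u * (dirD h v u * (1 / (2 * sqrt (h u))))) / (sqrt (h u) * sqrt (h u))"
    by (rule dirD_eq)
      (use assms in \<open>auto intro!: derivative_eq_intros has_derivative_dirD simp: field_simps\<close>)
  then have "dirD (\<lambda>u. f u / sqrt (h u)) v u * (sqrt (h u) * h u) =
    (dirD f v u * sqrt (h u) - f u * (dirD h v u * (1 / (2 * sqrt (h u))))) * sqrt (h u)"
    using assms(3) by simp
  also have "\<dots> = dirD f v u * (sqrt (h u) * sqrt (h u)) - f u * dirD h v u / 2"
    using assms(3) by (simp add: algebra_simps)
  finally show ?thesis using assms(3) by simp
qed

text \<open>In terms of the normal part \<open>N = cJ (D n u)\<close> of \<open>e\<close>, this says \<open>\<langle>N, J e\<rangle> = 0\<close>: by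
  \<open>angle_deriv\<close>, \<open>\<beta>\<close> is \<open>- \<langle>X, J e\<rangle>\<close> up to a constant, and \<open>\<Delta> X = H = N\<close>.\<close>
lemma stationary_orthogonal:
  assumes u: "u \<in> S" and e: "e = D t u + cJ (D n u)"
  shows "D t u \<bullet> D n u = 0"
proof -
  obtain W \<beta> where W: "open W" "u \<in> W" "W \<subseteq> S" and ang: "lagrangian_angle_on X \<beta> W"
    and lap: "laplacian X \<beta> u = 0" using angle[OF u] by blast
  let ?e1 = "axis 1 1 :: real^2" and ?e2 = "axis 2 1 :: real^2"
  \<comment> \<open>By \<open>angle_deriv\<close>, on \<open>W\<close> the value \<open>y v\<close>
    is the derivative of \<open>\<beta>\<close> along \<open>v\<close>. Accordingly
    \<open>f1\<close> and \<open>f2\<close> below are \<open>gdet\<close> times the components of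
    the gradient of \<open>\<beta>\<close>.\<close>
  define y where "y v x = e \<bullet> cJ (D v x)" for v x
  have diff_y: "y v differentiable (at x)" if "x \<in> S" for v x
    unfolding y_def[abs_def] by (intro differentiable_inner differentiable_const diff_cJD that)
  have dy: "dirD (y v) w u = e \<bullet> cJ (DD v w u)" for v w
    unfolding y_def[abs_def] using u
    by (simp add: dirD_inner diff_cJD dirD_bounded_linear bounded_linear_cJ diff_D)
  define f1 where "f1 x = G x * y ?e1 x - F x * y ?e2 x" for x
  define f2 where "f2 x = E x * y ?e2 x - F x * y ?e1 x" for x
  have diff_f: "f1 differentiable (at x)" "f2 differentiable (at x)" if "x \<in> S" for x
    unfolding f1_def[abs_def] f2_def[abs_def]
    by (intro differentiable_diff differentiable_mult diff_y diff_EFG that)+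
  have df1: "dirD f1 v u = dirD G v u * y ?e1 u + G u * dirD (y ?e1) v u - dirD F v u * y ?e2 u - F u * dirD (y ?e2) v u" for v
    unfolding f1_def[abs_def]
    by (rule dirD_eq) (auto intro!: derivative_eq_intros has_derivative_dirD diff_EFG diff_y u simp: algebra_simps)
  have df2: "dirD f2 v u = dirD E v u * y ?e2 u + E u * dirD (y ?e2) v u - dirD F v u * y ?e1 u - F u * dirD (y ?e1) v u" for v
    unfolding f2_def[abs_def]
    by (rule dirD_eq) (auto intro!: derivative_eq_intros has_derivative_dirD diff_EFG diff_y u simp: algebra_simps)
  have rs: "sqrt (gdet x) * (c / gdet x) = c / sqrt (gdet x)" if "x \<in> W" for x c
    using gdet_pos[of x] W(3) that by (smt (verit) nonzero_mult_div_cancel_left real_sqrt_gt_0_iff real_sqrt_mult_self subsetD times_divide_eq_right mult_divide_mult_cancel_left)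
  have dquot: "(\<lambda>x. f1 x / sqrt (gdet x)) differentiable (at u)" "(\<lambda>x. f2 x / sqrt (gdet x)) differentiable (at u)"
  proof -
    have "(\<lambda>x. sqrt (gdet x)) differentiable (at u)"
      using has_derivative_real_sqrt[OF gdet_pos[OF u] has_derivative_dirD[OF diff_EFG(4)[OF u]]]
        differentiableI by blast
    then show "(\<lambda>x. f1 x / sqrt (gdet x)) differentiable (at u)" "(\<lambda>x. f2 x / sqrt (gdet x)) differentiable (at u)"
      using gdet_pos[OF u] by (intro differentiable_divide diff_f u; simp)+
  qed
  have t1: "pd 1 (\<lambda>v. area_density X v * (\<Sum>j\<in>UNIV. gram_inv X v $ 1 $ j * pd j \<beta> v)) u
    = dirD (\<lambda>x. f1 x / sqrt (gdet x)) ?e1 u"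
    unfolding pd_eq_dirD[of 1]
    by (rule dirD_cong[OF W(1,2) _ dquot(1)])
      (use W(3) in \<open>auto simp: sum_2 pd_eq_dirD angle_deriv[OF W(1,3) _ ang] gram_inv_nth subset_eq area_density_eq
        rs[symmetric] f1_def y_def diff_divide_distrib right_diff_distrib\<close>)
  have t2: "pd 2 (\<lambda>v. area_density X v * (\<Sum>j\<in>UNIV. gram_inv X v $ 2 $ j * pd j \<beta> v)) u
    = dirD (\<lambda>x. f2 x / sqrt (gdet x)) ?e2 u"
    unfolding pd_eq_dirD[of 2]
    by (rule dirD_cong[OF W(1,2) _ dquot(2)])
      (use W(3) in \<open>auto simp: sum_2 pd_eq_dirD angle_deriv[OF W(1,3) _ ang] gram_inv_nth subset_eq area_density_eq
        rs[symmetric] f2_def y_def diff_divide_distrib right_diff_distrib\<close>)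
  have g: "gdet u > 0" by (rule gdet_pos[OF u])
  have "dirD (\<lambda>x. f1 x / sqrt (gdet x)) ?e1 u + dirD (\<lambda>x. f2 x / sqrt (gdet x)) ?e2 u = 0"
  proof -
    have "(pd 1 (\<lambda>v. area_density X v * (\<Sum>j\<in>UNIV. gram_inv X v $ 1 $ j * pd j \<beta> v)) u
      + pd 2 (\<lambda>v. area_density X v * (\<Sum>j\<in>UNIV. gram_inv X v $ 2 $ j * pd j \<beta> v)) u) / area_density X u = 0"
      using lap unfolding laplacian_def by (simp only: sum_2)
    then show ?thesis using g unfolding t1 t2 by (simp add: area_density_eq)
  qed
  then have "(dirD (\<lambda>x. f1 x / sqrt (gdet x)) ?e1 u + dirD (\<lambda>x. f2 x / sqrt (gdet x)) ?e2 u) * (sqrt (gdet u) * gdet u) = 0"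
    by simp
  then have Q: "dirD f1 ?e1 u * gdet u - f1 u * dirD gdet ?e1 u / 2
     + (dirD f2 ?e2 u * gdet u - f2 u * dirD gdet ?e2 u / 2) = 0"
    unfolding distrib_right dirD_div_sqrt[OF diff_f(1)[OF u] diff_EFG(4)[OF u] g]
      dirD_div_sqrt[OF diff_f(2)[OF u] diff_EFG(4)[OF u] g] .
  define n1 n2 t1 t2 where nt: "n1 = n $ 1" "n2 = n $ 2" "t1 = t $ 1" "t2 = t $ 2"
  have y_eq: "y v u = D n u \<bullet> D v u" for v
    unfolding y_def e using u by (simp add: inner_add_left)
  have y12: "y ?e1 u = n1 * E u + n2 * F u" "y ?e2 u = n1 * F u + n2 * G u"
    unfolding y_eq D_decomp[OF u, of n] nt by (simp_all add: inner_add_left inner_D_EFG)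
  have dy_eq: "dirD (y v) w u = n1 * (DD v w u \<bullet> D ?e1 u) + n2 * (DD v w u \<bullet> D ?e2 u)
      - (t1 * C v w ?e1 u + t2 * C v w ?e2 u)" for v w
  proof -
    have "dirD (y v) w u = DD v w u \<bullet> D n u - DD v w u \<bullet> cJ (D t u)"
    proof -
      have "D t u \<bullet> cJ (DD v w u) = - (DD v w u \<bullet> cJ (D t u))"
        using inner_cJ_left[of "D t u" "DD v w u"] inner_commute[of "cJ (D t u)" "DD v w u"] by simp
      then show ?thesis
        unfolding dy e using inner_commute[of "D n u" "DD v w u"] by (simp add: inner_add_left)
    qed
    then show ?thesis
      unfolding D_decomp[OF u, of n] D_decomp[OF u, of t] nt
      by (simp add: inner_add_right C_def)
  qed
  have sol: "G u * C ?e1 ?e1 ?e1 u - 2 * F u * C ?e1 ?e2 ?e1 u + E u * C ?e2 ?e2 ?e1 u = gdet u * y ?e1 u"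
    "G u * C ?e1 ?e1 ?e2 u - 2 * F u * C ?e1 ?e2 ?e2 u + E u * C ?e2 ?e2 ?e2 u = gdet u * y ?e2 u"
    using soliton_C[OF u] unfolding y_def by auto
  have DD21: "DD ?e2 ?e1 u = DD ?e1 ?e2 u" "C ?e2 ?e1 v u = C ?e1 ?e2 v u" for v
    using DD_commute[OF u] C_swap12[OF u] by auto
  have inc: "D x u \<bullet> DD v w u = DD v w u \<bullet> D x u" for x v w by (rule inner_commute)
  \<comment> \<open>The tangential parts of the second derivatives cancel against the derivatives of
    the metric; what remains is the trace of \<open>C\<close> paired with \<open>t\<close>.\<close>
  have "dirD f1 ?e1 u * gdet u - f1 u * dirD gdet ?e1 u / 2
     + (dirD f2 ?e2 u * gdet u - f2 u * dirD gdet ?e2 u / 2)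
    = - gdet u * (t1 * (G u * C ?e1 ?e1 ?e1 u - 2 * F u * C ?e1 ?e2 ?e1 u + E u * C ?e2 ?e2 ?e1 u)
      + t2 * (G u * C ?e1 ?e1 ?e2 u - 2 * F u * C ?e1 ?e2 ?e2 u + E u * C ?e2 ?e2 ?e2 u))"
    unfolding df1 df2 dy_eq dirD_gdet[OF u] dirD_EFG[OF u] f1_def f2_def y12 DD21 inc gdet_def[of u]
    by (simp add: field_simps)
  then have "gdet u * (gdet u * (t1 * y ?e1 u + t2 * y ?e2 u)) = 0"
    unfolding sol Q by (simp add: algebra_simps)
  then have "t1 * y ?e1 u + t2 * y ?e2 u = 0" using g by simp
  moreover have "D t u \<bullet> D n u = t1 * y ?e1 u + t2 * y ?e2 u"
    unfolding y_eq D_decomp[OF u, of t] nt by (simp add: inner_add_left inner_add_right inner_commute)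
  ultimately show ?thesis by simp
qed

end

section \<open>Adapted frames and first integrals\<close>

lemma linear_eq_on_frame:
  fixes f g :: "real^2 \<Rightarrow> 'b::real_vector"
  assumes "linear f" "linear g" "f a = g a" "f b = g b" "v = x *\<^sub>R a + y *\<^sub>R b"
  shows "f v = g v"
  using assms by (simp add: linear_add linear_scale)

lemma zero_derivative_ball:
  fixes f :: "'a::real_normed_vector \<Rightarrow> 'b::real_normed_vector"
  assumes r: "r > 0" "ball u r \<subseteq> S"
    and f: "\<And>x. x \<in> S \<Longrightarrow> (f has_derivative (\<lambda>v. 0)) (at x)" and x: "x \<in> ball u r"
  shows "f x = f u"
proof (rule has_derivative_zero_unique[OF convex_ball _ x])
  show "u \<in> ball u r" using r by simp
  show "(f has_derivative (\<lambda>v. 0)) (at y within ball u r)" if "y \<in> ball u r" for y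
    using f r(2) that has_derivative_at_withinI by blast
qed

context lagrangian_param
begin

text \<open>The value of \<open>exp (2 \<i> \<beta>)\<close>; squaring removes the dependence on the orientation.\<close>
definition \<Theta> where "\<Theta> u = (dz1_dz2 (D (axis 1 1) u) (D (axis 2 1) u))\<^sup>2 / of_real (gdet u)"

text \<open>Passing to an orthonormal basis multiplies \<open>dz1_dz2\<close> by a determinant
  \<open>d\<close> with \<open>d\<^sup>2 * gdet u = 1\<close>, and squaring absorbs its sign. The
  right-hand side refers only to the tangent plane, which later gives independence of the
  chart.\<close>

lemma Theta_eq:
  assumes u: "u \<in> S" and p: "p \<in> tangent_plane X u" and r: "r \<in> tangent_plane X u"
    and o: "p \<bullet> p = 1" "r \<bullet> r = 1" "p \<bullet> r = 0"
  shows "\<Theta> u = (dz1_dz2 p r)\<^sup>2"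
proof -
  let ?O = "dz1_dz2 (D (axis 1 1) u) (D (axis 2 1) u)"
  obtain a b where ab: "p = D a u" "r = D b u" using p r unfolding tangent_plane_eq by blast
  define d where "d = a $ 1 * b $ 2 - a $ 2 * b $ 1"
  have w: "dz1_dz2 p r = of_real d * ?O"
    unfolding ab D_decomp[OF u, of a] D_decomp[OF u, of b] d_def
    using dz1_dz2_commute[of "D (axis 2 1) u" "D (axis 1 1) u"]
    by (simp add: scaleR_conv_of_real algebra_simps)
  have hD: "herm (D x u) (D y u) = of_real (D x u \<bullet> D y u)" for x y
    by (simp add: herm_def u)
  have 1: "dz1_dz2 p r * cnj (dz1_dz2 p r) = 1"
    unfolding Cauchy_Binet_dz1_dz2 using o unfolding ab hD by (simp add: inner_commute)
  have "?O * cnj ?O = of_real (gdet u)"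
    unfolding Cauchy_Binet_dz1_dz2 hD by (simp add: inner_D_EFG gdet_def)
  then have "of_real (d\<^sup>2 * gdet u) = (1::complex)"
    using 1 unfolding w by (simp add: power2_eq_square mult.assoc mult.left_commute)
  then have dg: "d\<^sup>2 * gdet u = 1" using of_real_eq_1_iff by blast
  have "\<Theta> u = of_real (d\<^sup>2 * gdet u) * \<Theta> u" using dg by simp
  also have "\<dots> = (dz1_dz2 p r)\<^sup>2"
    unfolding w \<Theta>_def using gdet_pos[OF u] by (simp add: power_mult_distrib)
  finally show ?thesis .
qed

end

context soliton_param
begin

definition k where "k = e \<bullet> e"

lemma k_pos: "k > 0"
  using e_nz by (simp add: k_def)

text \<open>The squared length of the normal part of \<open>e\<close>.\<close>
definition s where "s u = k - T e u \<bullet> T e u"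

text \<open>A complex linear functional that vanishes on the complex line of \<open>e\<close>; up to
  scale, phase and translation it becomes the second coordinate of the model.\<close>

definition om where "om v = dz1_dz2 e v"

lemma om_bounded_linear: "bounded_linear om"
  unfolding om_def[abs_def] by (rule bounded_bilinear.bounded_linear_right[OF bounded_bilinear_dz1_dz2])

end

section \<open>The second fundamental form in a frame adapted to the translating vector\<close>

locale adapted_frame = soliton_param +
  fixes u a b \<tau> \<nu>
  assumes u: "u \<in> S"
    and ortho: "D a u \<bullet> D a u = 1" "D b u \<bullet> D b u = 1" "D a u \<bullet> D b u = 0"
    and e_eq: "e = \<tau> *\<^sub>R D a u + \<nu> *\<^sub>R cJ (D b u)"
begin

sublocale lagrangian_frame "D a u" "D b u"
  by (rule frame_at[OF u ortho])

lemma k_eq: "k = \<tau>\<^sup>2 + \<nu>\<^sup>2"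
  unfolding k_def unfolding e_eq by (simp add: inner_add_left inner_add_right power2_eq_square)

lemma T_eq: "T e u = \<tau> *\<^sub>R D a u"
proof -
  have "T e u \<bullet> D a u = \<tau>" "T e u \<bullet> D b u = 0"
    unfolding T_inner[OF u] by (simp_all add: e_eq inner_add_left)
  then show ?thesis using frame_expansion[of "T e u"] by (simp add: T_cJ[OF u])
qed

lemma s_eq: "s u = \<nu>\<^sup>2"
  by (simp add: s_def k_eq T_eq power2_eq_square)

lemma C_trace_frame: "C a a v u + C b b v u = \<nu> * (D b u \<bullet> D v u)"
  unfolding soliton_trace[OF u ortho] e_eq using u by (simp add: inner_add_left)

text \<open>The first product comes from differentiating
  \<open>T e u \<bullet> D v u = e \<bullet> D v u\<close>, where the normal part
  \<open>\<nu> *\<^sub>R cJ (D b u)\<close> of \<open>e\<close> remains; the second from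
  differentiating \<open>T e u \<bullet> cJ (D v u) = 0\<close>.\<close>

lemma dT_inner:
  "dirD (T e) w u \<bullet> D v u = \<nu> * C v w b u"
  "dirD (T e) w u \<bullet> cJ (D v u) = \<tau> * C v w a u"
proof -
  have "dirD (\<lambda>u. T e u \<bullet> D v u) w u = dirD (\<lambda>u. e \<bullet> D v u) w u"
    by (rule dirD_cong[OF open_S u T_inner[of _ e]]) (assumption, intro differentiable_inner differentiable_const diff_D u)
  then have 1: "dirD (T e) w u \<bullet> D v u = (e - T e u) \<bullet> DD v w u"
    using u by (simp add: dirD_inner diff_T diff_D inner_diff_left)
  have N: "e - T e u = \<nu> *\<^sub>R cJ (D b u)" by (subst e_eq) (simp add: T_eq)
  show "dirD (T e) w u \<bullet> D v u = \<nu> * C v w b u"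
    unfolding 1 N by (simp add: C_def inner_commute)
  have "dirD (\<lambda>u. T e u \<bullet> cJ (D v u)) w u = 0"
    by (rule dirD_zero_on_open[OF open_S u T_cJ])
  then have "dirD (T e) w u \<bullet> cJ (D v u) + T e u \<bullet> cJ (DD v w u) = 0"
    using u by (simp add: dirD_inner diff_T diff_cJD dirD_bounded_linear bounded_linear_cJ diff_D)
  moreover have "T e u \<bullet> cJ (DD v w u) = - \<tau> * C v w a u"
    unfolding T_eq C_def using inner_cJ_left[of "D a u" "DD v w u"] inner_commute[of "cJ (D a u)" "DD v w u"] by simp
  ultimately show "dirD (T e) w u \<bullet> cJ (D v u) = \<tau> * C v w a u" by simp
qed

text \<open>Obtained by differentiating \<open>\<langle>J e, T\<rangle> = 0\<close>.\<close>
lemma C_balance: "\<nu>\<^sup>2 * C b w b u = \<tau>\<^sup>2 * C a w a u"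
proof -
  have z: "cJ e \<bullet> T e x = 0" if x: "x \<in> S" for x
  proof -
    obtain t n where tn: "e = D t x + cJ (D n x)" using D_cJ_decomp[OF x] .
    have "cJ e \<bullet> D t x = 0"
      using stationary_orthogonal[OF x tn] x inner_commute[of "D n x" "D t x"]
      by (subst tn) (simp add: inner_diff_left inner_add_left)
    moreover have "T e x = D t x"
    proof -
      obtain t' where t': "T e x = D t' x" using T_in_range[OF x] .
      have "(T e x - D t x) \<bullet> D v x = 0" for v
        unfolding inner_diff_left T_inner[OF x] using x by (subst tn) (simp add: inner_add_left)
      from this[of "t' - t"] show ?thesis unfolding t' by (simp add: D_linear[OF x])
    qed
    ultimately show ?thesis by simp
  qed
  have ce: "cJ e = \<tau> *\<^sub>R cJ (D a u) - \<nu> *\<^sub>R D b u"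
    by (subst e_eq) simp
  have "dirD (\<lambda>x. cJ e \<bullet> T e x) w u = 0" by (rule dirD_zero_on_open[OF open_S u z])
  then have "cJ e \<bullet> dirD (T e) w u = 0"
    using u by (simp add: dirD_inner diff_T)
  then have "\<tau> * (dirD (T e) w u \<bullet> cJ (D a u)) - \<nu> * (dirD (T e) w u \<bullet> D b u) = 0"
    unfolding ce by (simp add: inner_diff_left inner_diff_right inner_commute[of _ "dirD (T e) w u"])
  then show ?thesis unfolding dT_inner by (simp add: power2_eq_square)
qed

text \<open>The trace equations \<open>A\<close> and the balance equations \<open>B\<close> form two
  linear systems whose determinant is, up to sign,
  \<open>k = \<tau>\<^sup>2 + \<nu>\<^sup>2\<close>. Since \<open>k > 0\<close>, they can be solved
  also where \<open>\<tau>\<close> or \<open>\<nu>\<close> vanishes.\<close>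

lemma C_values:
  "C a a a u = 0" "C a b b u = 0" "k * C a a b u = \<nu> ^ 3" "k * C b b b u = \<tau>\<^sup>2 * \<nu>"
proof -
  have sym: "C b a b u = C a b b u" "C b b a u = C a b b u" "C a b a u = C a a b u"
    using C_swap12[OF u] C_swap13[OF u] by metis+
  have A: "C a a a u + C a b b u = 0" "C a a b u + C b b b u = \<nu>"
    using C_trace_frame[of a] C_trace_frame[of b] sym by simp_all
  have B: "\<nu>\<^sup>2 * C a b b u = \<tau>\<^sup>2 * C a a a u" "\<nu>\<^sup>2 * C b b b u = \<tau>\<^sup>2 * C a a b u"
    using C_balance[of a] C_balance[of b] sym by simp_all
  have "k * C a a a u = 0" using A(1) B(1) unfolding k_eq by algebra
  then show 1: "C a a a u = 0" using k_pos by simp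
  then show "C a b b u = 0" using A by simp
  have "k * C a a b u = \<nu>\<^sup>2 * (C a a b u + C b b b u)" "k * C b b b u = \<tau>\<^sup>2 * (C a a b u + C b b b u)"
    unfolding k_eq using B(2) by (simp_all add: algebra_simps)
  then show "k * C a a b u = \<nu> ^ 3" "k * C b b b u = \<tau>\<^sup>2 * \<nu>"
    unfolding A(2) by (simp_all add: power2_eq_square power3_eq_cube)
qed

lemma dT:
  "k *\<^sub>R dirD (T e) a u = \<nu> ^ 4 *\<^sub>R D a u + (\<tau> * \<nu> ^ 3) *\<^sub>R cJ (D b u)"
  "k *\<^sub>R dirD (T e) b u = (\<tau>\<^sup>2 * \<nu>\<^sup>2) *\<^sub>R D b u + (\<tau> * \<nu> ^ 3) *\<^sub>R cJ (D a u)"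
proof -
  have sym: "C b a b u = C a b b u" "C b b a u = C a b b u" "C a b a u = C a a b u" "C b a a u = C a a b u"
    using C_swap12[OF u] C_swap13[OF u] by metis+
  have x: "dirD (T e) w u = (\<nu> * C a w b u) *\<^sub>R D a u + (\<nu> * C b w b u) *\<^sub>R D b u
     + (\<tau> * C a w a u) *\<^sub>R cJ (D a u) + (\<tau> * C b w a u) *\<^sub>R cJ (D b u)" for w
    using frame_expansion[of "dirD (T e) w u"] unfolding dT_inner .
  have m: "k * (\<nu> * C a a b u) = \<nu> ^ 4" "k * (\<tau> * C a a b u) = \<tau> * \<nu> ^ 3"
    "k * (\<nu> * C b b b u) = \<tau>\<^sup>2 * \<nu>\<^sup>2"
    using C_values by algebra+
  show "k *\<^sub>R dirD (T e) a u = \<nu> ^ 4 *\<^sub>R D a u + (\<tau> * \<nu> ^ 3) *\<^sub>R cJ (D b u)"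
    unfolding x sym by (simp add: C_values scaleR_add_right m)
  show "k *\<^sub>R dirD (T e) b u = (\<tau>\<^sup>2 * \<nu>\<^sup>2) *\<^sub>R D b u + (\<tau> * \<nu> ^ 3) *\<^sub>R cJ (D a u)"
    unfolding x sym by (simp add: C_values scaleR_add_right m)
qed

text \<open>\<open>om\<close> vanishes on \<open>e\<close> itself; the relation is this fact
  expanded in the frame.\<close>

lemma om_frame: "\<tau> *\<^sub>R om (D a u) = - (\<i> * \<nu> *\<^sub>R om (D b u))"
proof -
  have 0: "dz1_dz2 e e = 0" by simp
  have "om (\<tau> *\<^sub>R D a u + \<nu> *\<^sub>R cJ (D b u)) = 0" unfolding e_eq[symmetric] om_def by (rule 0)
  then show ?thesis by (simp add: om_def eq_neg_iff_add_eq_0)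
qed

text \<open>In the frame, \<open>om (T e u)\<close> is \<open>- \<i> * \<tau> * \<nu>\<close> times
  \<open>dz1_dz2 (D a u) (D b u)\<close>, while \<open>s u = \<nu>\<^sup>2\<close> and
  \<open>k - s u = \<tau>\<^sup>2\<close>.\<close>

lemma om_T_sq: "(om (T e u))\<^sup>2 = - of_real (s u * (k - s u)) * \<Theta> u"
proof -
  have th: "\<Theta> u = (dz1_dz2 (D a u) (D b u))\<^sup>2"
    by (rule Theta_eq[OF u]) (auto simp: tangent_plane_eq)
  have "om (T e u) = - (\<i> * (of_real \<nu> * of_real \<tau>) * dz1_dz2 (D a u) (D b u))"
    unfolding om_def T_eq by (subst e_eq) (simp add: scaleR_conv_of_real dz1_dz2_commute[of "D b u" "D a u"])
  then show ?thesis unfolding s_eq k_eq th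
    by (simp add: power2_eq_square algebra_simps)
qed

end

section \<open>The differential equation for the normal length and the first integrals\<close>

context soliton_param
begin

text \<open>By \<open>stationary_orthogonal\<close>, \<open>D t u\<close> and \<open>D n u\<close>
  are orthogonal in the tangent plane, so any orthonormal frame can be rotated until its first
  vector is parallel to the former and its second to the latter, even where one of them is
  zero.\<close>

lemma obtain_adapted_frame:
  assumes u: "u \<in> S"
  obtains a b \<tau> \<nu> where "adapted_frame X S e u a b \<tau> \<nu>"
proof -
  obtain a b where ab: "D a u \<bullet> D a u = 1" "D b u \<bullet> D b u = 1" "D a u \<bullet> D b u = 0"
    using orthonormal_frame[OF u] .
  interpret lagrangian_frame "D a u" "D b u" using frame_at[OF u ab] .
  obtain t n where tn: "e = D t u + cJ (D n u)" using D_cJ_decomp[OF u] .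
  define t1 t2 n1 n2 where t12: "t1 = D t u \<bullet> D a u" "t2 = D t u \<bullet> D b u" "n1 = D n u \<bullet> D a u" "n2 = D n u \<bullet> D b u"
  have t: "D t u = t1 *\<^sub>R D a u + t2 *\<^sub>R D b u" and n: "D n u = n1 *\<^sub>R D a u + n2 *\<^sub>R D b u"
    using frame_expansion[of "D t u"] frame_expansion[of "D n u"] u unfolding t12 by simp_all
  have tn0: "t1 * n1 + t2 * n2 = 0"
    using stationary_orthogonal[OF u tn] unfolding t n by (simp add: inner_add_left inner_add_right mult.commute)
  \<comment> \<open>\<open>(x, y)\<close> are the coordinates of the first rotated vector, a unit
    vector parallel to \<open>D t u\<close> and orthogonal to \<open>D n u\<close>.\<close>
  have "\<exists>x y. x * x + y * y = 1 \<and> t1 * y = t2 * x \<and> n1 * x + n2 * y = 0"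
  proof (cases "t1 = 0 \<and> t2 = 0")
    case False
    define q where "q = sqrt (t1 * t1 + t2 * t2)"
    have "t1 * t1 + t2 * t2 > 0" using False by (simp add: sum_squares_gt_zero_iff)
    then have q: "q > 0" "q * q = t1 * t1 + t2 * t2" unfolding q_def by simp_all
    show ?thesis
      by (rule exI[of _ "t1 / q"], rule exI[of _ "t2 / q"])
        (use q tn0 False in \<open>simp add: add_divide_distrib[symmetric] mult.commute\<close>)
  next
    case True
    show ?thesis
    proof (cases "n1 = 0 \<and> n2 = 0")
      case False
      define q where "q = sqrt (n1 * n1 + n2 * n2)"
      have "n1 * n1 + n2 * n2 > 0" using False by (simp add: sum_squares_gt_zero_iff)
      then have q: "q > 0" "q * q = n1 * n1 + n2 * n2" unfolding q_def by simp_all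
      \<comment> \<open>Here \<open>D t u\<close> is zero, and a quarter turn of the normalised
        \<open>D n u\<close> serves.\<close>
      show ?thesis
        by (rule exI[of _ "n2 / q"], rule exI[of _ "- n1 / q"])
          (use q True False in \<open>simp add: add_divide_distrib[symmetric] diff_divide_distrib[symmetric] mult.commute\<close>)
    next
      case n0: True
      show ?thesis by (rule exI[of _ 1], rule exI[of _ 0]) (use True n0 in simp)
    qed
  qed
  then obtain x y where xy: "x * x + y * y = 1" "t1 * y = t2 * x" "n1 * x + n2 * y = 0" by blast
  have "adapted_frame X S e u (x *\<^sub>R a + y *\<^sub>R b) ((- y) *\<^sub>R a + x *\<^sub>R b) (t1 * x + t2 * y) (n2 * x - n1 * y)"
  proof
    show "u \<in> S" by (rule u)
    show "D (x *\<^sub>R a + y *\<^sub>R b) u \<bullet> D (x *\<^sub>R a + y *\<^sub>R b) u = 1"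
      using xy by (simp add: D_linear[OF u] inner_add_left inner_add_right)
    show "D ((- y) *\<^sub>R a + x *\<^sub>R b) u \<bullet> D ((- y) *\<^sub>R a + x *\<^sub>R b) u = 1"
      using xy by (simp add: D_linear[OF u] inner_diff_left inner_diff_right inner_add_left inner_add_right)
    show "D (x *\<^sub>R a + y *\<^sub>R b) u \<bullet> D ((- y) *\<^sub>R a + x *\<^sub>R b) u = 0"
      using xy by (simp add: D_linear[OF u] inner_diff_left inner_diff_right inner_add_left inner_add_right)
    have c: "t1 = (t1 * x + t2 * y) * x" "t2 = (t1 * x + t2 * y) * y"
      "n1 = - (n2 * x - n1 * y) * y" "n2 = (n2 * x - n1 * y) * x"
      using xy by algebra+
    have "e = t1 *\<^sub>R D a u + t2 *\<^sub>R D b u + n1 *\<^sub>R cJ (D a u) + n2 *\<^sub>R cJ (D b u)"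
      unfolding tn t n by simp
    also have "\<dots> = ((t1 * x + t2 * y) * x) *\<^sub>R D a u + ((t1 * x + t2 * y) * y) *\<^sub>R D b u
       + (- (n2 * x - n1 * y) * y) *\<^sub>R cJ (D a u) + ((n2 * x - n1 * y) * x) *\<^sub>R cJ (D b u)"
      using c by simp
    also have "\<dots> = (t1 * x + t2 * y) *\<^sub>R D (x *\<^sub>R a + y *\<^sub>R b) u + (n2 * x - n1 * y) *\<^sub>R cJ (D ((- y) *\<^sub>R a + x *\<^sub>R b) u)"
      by (simp add: D_linear[OF u] algebra_simps)
    finally show "e = (t1 * x + t2 * y) *\<^sub>R D (x *\<^sub>R a + y *\<^sub>R b) u + (n2 * x - n1 * y) *\<^sub>R cJ (D ((- y) *\<^sub>R a + x *\<^sub>R b) u)" .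
  qed
  then show thesis by (rule that)
qed

lemma s_bounds: assumes "u \<in> S" shows "0 \<le> s u" "s u \<le> k"
proof -
  obtain a b \<tau> \<nu> where "adapted_frame X S e u a b \<tau> \<nu>" using obtain_adapted_frame[OF assms] .
  then interpret adapted_frame X S e u a b \<tau> \<nu> .
  show "0 \<le> s u" "s u \<le> k" by (simp_all add: s_eq k_eq)
qed

lemma om_T: "u \<in> S \<Longrightarrow> (om (T e u))\<^sup>2 = - of_real (s u * (k - s u)) * \<Theta> u"
  using obtain_adapted_frame adapted_frame.om_T_sq by metis

lemma diff_s: "u \<in> S \<Longrightarrow> s differentiable (at u)"
  unfolding s_def[abs_def] by (intro differentiable_diff differentiable_inner differentiable_const diff_T)

text \<open>Both sides are linear in \<open>v\<close>, so the frame vectors suffice. The derivative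
  of \<open>s\<close> is \<open>- 2\<close> times the product of the derivative of
  \<open>T e\<close> with \<open>T e\<close>, and \<open>dT\<close> evaluates it without dividing by
  \<open>\<tau>\<close> or \<open>\<nu>\<close>, so their zeros are covered.\<close>

lemma dirD_s: assumes u: "u \<in> S" shows "dirD s v u = - (2 / k) * (s u)\<^sup>2 * (e \<bullet> D v u)"
proof -
  obtain a b \<tau> \<nu> where "adapted_frame X S e u a b \<tau> \<nu>" using obtain_adapted_frame[OF u] .
  then interpret adapted_frame X S e u a b \<tau> \<nu> .
  have ds: "k * dirD s v u = - 2 * \<tau> * (k *\<^sub>R dirD (T e) v u \<bullet> D a u)" for v
  proof -
    have "dirD s v u = - 2 * (dirD (T e) v u \<bullet> T e u)"
      unfolding s_def[abs_def]
      by (rule dirD_eq) (auto intro!: derivative_eq_intros has_derivative_dirD diff_T u simp: inner_commute)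
    then show ?thesis unfolding T_eq by simp
  qed
  have ev: "e \<bullet> D a u = \<tau>" "e \<bullet> D b u = 0" by (subst e_eq, simp add: inner_add_left)+
  have 1: "dirD s a u = - (2 / k) * (s u)\<^sup>2 * (e \<bullet> D a u)"
    using ds[of a] k_pos unfolding dT ev s_eq by (simp add: inner_add_left field_simps)
  have 2: "dirD s b u = - (2 / k) * (s u)\<^sup>2 * (e \<bullet> D b u)"
    using ds[of b] k_pos unfolding dT ev s_eq by (simp add: inner_add_left)
  show ?thesis
    by (rule linear_eq_on_frame[OF linear_dirD[OF diff_s[OF u]] _ 1 2 frame_coords[OF u ortho]])
      (auto simp: linear_iff D_linear[OF u] inner_add_right algebra_simps add_divide_distrib)
qed

text \<open>Here \<open>\<nu> = 0\<close>, so \<open>C_values\<close> makes the whole cubic form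
  vanish; the normal part of each second derivative is then orthogonal to all four frame
  vectors.\<close>

lemma second_ff_zero:
  assumes u: "u \<in> S" and s0: "s u = 0"
  shows "second_ff X i j u = 0"
proof -
  obtain a b \<tau> \<nu> where "adapted_frame X S e u a b \<tau> \<nu>" using obtain_adapted_frame[OF u] .
  then interpret adapted_frame X S e u a b \<tau> \<nu> .
  have nu: "\<nu> = 0" using s0 s_eq by simp
  have C0: "C a a a u = 0" "C a b b u = 0" "C a a b u = 0" "C b b b u = 0"
    using C_values k_pos nu by auto
  have sym: "C b a b u = C a b b u" "C b b a u = C a b b u" "C a b a u = C a a b u" "C b a a u = C a a b u"
    using C_swap12[OF u] C_swap13[OF u] by metis+
  have C: "C v w y u = 0" for v w y
    by (subst frame_coords[OF u ortho, of v], subst frame_coords[OF u ortho, of w], subst frame_coords[OF u ortho, of y])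
      (simp add: C_linear[OF u] sym C0)
  let ?z = "DD (axis j 1) (axis i 1) u"
  have z: "second_ff X i j u = ?z - T ?z u"
    by (simp add: second_ff_def normal_part_eq[OF u] pd_eq_dirD)
  have "(?z - T ?z u) \<bullet> D v u = 0" for v by (simp add: inner_diff_left T_inner[OF u])
  moreover have "(?z - T ?z u) \<bullet> cJ (D v u) = 0" for v
    using C[of "axis j 1" "axis i 1" v] by (simp add: inner_diff_left T_cJ[OF u] C_def)
  ultimately show ?thesis
    unfolding z using frame_expansion[of "?z - T ?z u"] by simp
qed

lemma has_derivative_s:
  "u \<in> S \<Longrightarrow> (s has_derivative (\<lambda>v. - (2 / k) * (s u)\<^sup>2 * (e \<bullet> D v u))) (at u)"
  using has_derivative_dirD[OF diff_s] by (simp add: dirD_s)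

text \<open>Dividing \<open>dirD_s\<close> by \<open>- (s u)\<^sup>2\<close> shows that
  \<open>1 / s\<close> and \<open>(2 / k) * (e \<bullet> X x)\<close> have the same
  derivative.\<close>

lemma first_integral_s:
  assumes u: "u \<in> S" and s: "s u > 0"
  shows "((\<lambda>x. 1 / s x - (2 / k) * (e \<bullet> X x)) has_derivative (\<lambda>v. 0)) (at u)"
proof -
  have "((\<lambda>x. 1 / s x) has_derivative (\<lambda>v. (2 / k) * (e \<bullet> D v u))) (at u)"
    by (rule derivative_eq_intros has_derivative_s u refl)+
      (use s in \<open>auto simp: field_simps power2_eq_square\<close>)
  moreover have "((\<lambda>x. (2 / k) * (e \<bullet> X x)) has_derivative (\<lambda>v. (2 / k) * (e \<bullet> D v u))) (at u)"
    by (intro has_derivative_mult_right has_derivative_inner_right has_derivative_dirD diff_X u)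
  ultimately show ?thesis using has_derivative_diff by fastforce
qed

text \<open>The point is that \<open>om (T e x)\<close> divided by \<open>s x\<close> has derivative
  \<open>om (D v u)\<close>. By linearity it is checked on the frame, where multiplication by
  \<open>k * \<nu>\<^sup>2\<close>, nonzero because \<open>s u > 0\<close>, turns \<open>dT\<close>
  into the identities \<open>alg\<close>.\<close>

lemma first_integral_om:
  assumes u: "u \<in> S" and s: "s u > 0"
  shows "((\<lambda>x. (1 / s x) *\<^sub>R om (T e x) - om (X x)) has_derivative (\<lambda>v. 0)) (at u)"
proof -
  let ?f = "\<lambda>v. (1 / s u) *\<^sub>R om (dirD (T e) v u) + ((2 / k) * (e \<bullet> D v u)) *\<^sub>R om (T e u)"
  have omd: "((\<lambda>x. om (f x)) has_derivative (\<lambda>v. om (f' v))) (at u)" if "(f has_derivative f') (at u)" for f f'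
    using bounded_linear.has_derivative[OF om_bounded_linear that] .
  have inv: "((\<lambda>x. 1 / s x) has_derivative (\<lambda>v. (2 / k) * (e \<bullet> D v u))) (at u)"
    by (rule derivative_eq_intros has_derivative_s u refl)+
      (use s in \<open>auto simp: field_simps power2_eq_square\<close>)
  have d: "((\<lambda>x. (1 / s x) *\<^sub>R om (T e x) - om (X x)) has_derivative (\<lambda>v. ?f v - om (D v u))) (at u)"
    by (intro has_derivative_diff has_derivative_scaleR inv omd has_derivative_dirD diff_T diff_X u)
  obtain a b \<tau> \<nu> where "adapted_frame X S e u a b \<tau> \<nu>" using obtain_adapted_frame[OF u] .
  then interpret adapted_frame X S e u a b \<tau> \<nu> .
  have ev: "e \<bullet> D a u = \<tau>" "e \<bullet> D b u = 0" by (subst e_eq, simp add: inner_add_left)+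
  have om_simps: "om (x + y) = om x + om y" "om (c *\<^sub>R x) = of_real c * om x" "om (cJ x) = \<i> * om x" for x y c
    by (simp_all add: om_def scaleR_conv_of_real)
  have nu: "\<nu> \<noteq> 0" using s s_eq by auto
  have fr: "of_real \<tau> * om (D a u) = - (\<i> * (of_real \<nu> * om (D b u)))"
    using om_frame by (simp add: scaleR_conv_of_real)
  have kc: "of_real k = ((of_real \<tau>)\<^sup>2 + (of_real \<nu>)\<^sup>2 :: complex)" by (simp add: k_eq)
  have dTa: "of_real k * om (dirD (T e) a u) = of_real (\<nu> ^ 4) * om (D a u) + of_real (\<tau> * \<nu> ^ 3) * (\<i> * om (D b u))"
    using arg_cong[OF dT(1), of om] by (simp add: om_simps)
  have dTb: "of_real k * om (dirD (T e) b u) = of_real (\<tau>\<^sup>2 * \<nu>\<^sup>2) * om (D b u) + of_real (\<tau> * \<nu> ^ 3) * (\<i> * om (D a u))"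
    using arg_cong[OF dT(2), of om] by (simp add: om_simps)
  have k0: "of_real (k * \<nu>\<^sup>2) \<noteq> (0::complex)" using k_pos nu by simp
  have m: "of_real (k * \<nu>\<^sup>2) * ?f v = of_real k * om (dirD (T e) v u) + of_real (2 * \<nu>\<^sup>2 * (e \<bullet> D v u)) * om (T e u)" for v
    unfolding s_eq using nu k_pos by (simp add: scaleR_conv_of_real field_simps)
  \<comment> \<open>To be used with \<open>\<tau>\<close> and \<open>\<nu>\<close> for
    \<open>x\<close> and \<open>y\<close>, and with the values of \<open>om\<close> on the frame for
    \<open>p\<close> and \<open>r\<close>; the premise is then \<open>om_frame\<close>.\<close>
  have alg: "y ^ 4 * p + x * y ^ 3 * (\<i> * r) + 2 * y\<^sup>2 * x * (x * p) = (x\<^sup>2 + y\<^sup>2) * y\<^sup>2 * p"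
    "x\<^sup>2 * y\<^sup>2 * r + x * y ^ 3 * (\<i> * p) = (x\<^sup>2 + y\<^sup>2) * y\<^sup>2 * r"
    if xp: "x * p = - (\<i> * (y * r))" for x y p r :: complex
  proof -
    have yr: "y * r = \<i> * (x * p)" using xp by simp
    have "y ^ 4 * p + x * y ^ 3 * (\<i> * r) + 2 * y\<^sup>2 * x * (x * p)
      = y ^ 4 * p + x * y\<^sup>2 * (\<i> * (y * r)) + 2 * y\<^sup>2 * x * (x * p)"
      by (simp add: power2_eq_square power3_eq_cube)
    also have "\<i> * (y * r) = - (x * p)" using xp by simp
    finally show "y ^ 4 * p + x * y ^ 3 * (\<i> * r) + 2 * y\<^sup>2 * x * (x * p) = (x\<^sup>2 + y\<^sup>2) * y\<^sup>2 * p"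
      by (simp add: power2_eq_square power4_eq_xxxx algebra_simps)
    have "x\<^sup>2 * y\<^sup>2 * r + x * y ^ 3 * (\<i> * p) = x\<^sup>2 * y\<^sup>2 * r + y ^ 3 * (\<i> * (x * p))"
      by simp
    also have "\<i> * (x * p) = y * r" using yr by simp
    finally show "x\<^sup>2 * y\<^sup>2 * r + x * y ^ 3 * (\<i> * p) = (x\<^sup>2 + y\<^sup>2) * y\<^sup>2 * r"
      by (simp add: power2_eq_square power3_eq_cube algebra_simps)
  qed
  have "of_real (k * \<nu>\<^sup>2) * ?f a = of_real (k * \<nu>\<^sup>2) * om (D a u)"
    by (rule trans[OF m])
      (unfold dTa, unfold T_eq om_simps ev of_real_mult of_real_power kc alg(1)[OF fr, symmetric], simp)
  then have 1: "?f a = om (D a u)" using k0 mult_left_cancel by blast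
  have "of_real (k * \<nu>\<^sup>2) * ?f b = of_real (k * \<nu>\<^sup>2) * om (D b u)"
    by (rule trans[OF m])
      (unfold dTb, unfold ev of_real_mult of_real_power kc alg(2)[OF fr, symmetric], simp)
  then have 2: "?f b = om (D b u)" using k0 mult_left_cancel by blast
  have "?f v = om (D v u)" for v
    by (rule linear_eq_on_frame[OF _ _ 1 2 frame_coords[OF u ortho]])
      (auto simp: linear_iff D_linear[OF u] dirD_linear_simps[OF diff_T[OF u]] om_simps inner_add_right algebra_simps add_divide_distrib scaleR_conv_of_real[where 'a = complex])
  then show ?thesis using d by simp
qed

text \<open>On \<open>W\<close> the function is the exponential of \<open>2 * \<i>\<close> times
  \<open>\<beta> x + X x \<bullet> cJ e\<close>, and the two summands have opposite derivatives by
  \<open>angle_deriv\<close>.\<close>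

lemma first_integral_Theta:
  assumes u: "u \<in> S"
  shows "((\<lambda>x. \<Theta> x * exp (\<i> * of_real (2 * (X x \<bullet> cJ e)))) has_derivative (\<lambda>v. 0)) (at u)"
proof -
  obtain W \<beta> where W: "open W" "u \<in> W" "W \<subseteq> S" and ang: "lagrangian_angle_on X \<beta> W"
    using angle[OF u] by blast
  have beta: "\<beta> differentiable (at u)"
    using ang W(2) smooth_on_differentiable unfolding lagrangian_angle_on_def by blast
  have eq: "\<Theta> x * exp (\<i> * of_real (2 * (X x \<bullet> cJ e))) = exp (\<i> * of_real (2 * (\<beta> x + X x \<bullet> cJ e)))" if "x \<in> W" for x
  proof -
    have g: "gdet x > 0" using gdet_pos W(3) that by blast
    have "\<Omega> x = exp (\<i> * of_real (\<beta> x)) * of_real (sqrt (gdet x))"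
      using ang that unfolding lagrangian_angle_on_def pd_eq_dirD area_density_eq by blast
    then have "(\<Omega> x)\<^sup>2 = (exp (\<i> * of_real (\<beta> x)))\<^sup>2 * of_real ((sqrt (gdet x))\<^sup>2)"
      by (simp add: power_mult_distrib)
    then have "\<Theta> x = (exp (\<i> * of_real (\<beta> x)))\<^sup>2" using g by (simp add: \<Theta>_def)
    also have "\<dots> = exp (\<i> * of_real (2 * \<beta> x))" by (simp add: exp_double[symmetric] algebra_simps)
    finally show ?thesis by (simp add: exp_add[symmetric] algebra_simps)
  qed
  have "((\<lambda>x. \<i> * of_real (2 * (\<beta> x + X x \<bullet> cJ e))) has_derivative
     (\<lambda>v. \<i> * of_real (2 * (dirD \<beta> v u + D v u \<bullet> cJ e)))) (at u)"
    by (auto intro!: derivative_eq_intros has_derivative_dirD[OF beta] has_derivative_dirD[OF diff_X[OF u]])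
  moreover have "dirD \<beta> v u + D v u \<bullet> cJ e = 0" for v
    using angle_deriv[OF W(1,3,2) ang, of v] inner_cJ_left[of e "D v u"] inner_commute[of "cJ e" "D v u"] by simp
  ultimately have "((\<lambda>x. \<i> * of_real (2 * (\<beta> x + X x \<bullet> cJ e))) has_derivative (\<lambda>v. 0)) (at u)" by simp
  from has_derivative_compose[OF this DERIV_exp[unfolded has_field_derivative_def]]
  have "((\<lambda>x. exp (\<i> * of_real (2 * (\<beta> x + X x \<bullet> cJ e)))) has_derivative (\<lambda>v. 0)) (at u)" by simp
  then show ?thesis
    by (rule has_derivative_transform_within_open[OF _ W(1,2) eq[symmetric]])
qed

text \<open>Positivity persists by continuity. Vanishing persists along segments from
  \<open>u\<close>: there \<open>dirD_s\<close> is an ordinary differential equation with bounded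
  coefficient, and a Gronwall estimate leaves only the zero solution.\<close>

lemma s_sign_locally_constant:
  assumes u: "u \<in> S"
  obtains B where "open B" "u \<in> B" "B \<subseteq> S" "\<And>x. x \<in> B \<Longrightarrow> s x > 0 \<longleftrightarrow> s u > 0"
proof (cases "s u > 0")
  case True
  have "continuous_on S s"
    using diff_s differentiable_imp_continuous_within by (metis continuous_at_imp_continuous_on)
  then have o: "open (S \<inter> s -` {0<..})"
    using continuous_on_open_vimage[OF open_S] by (metis Int_commute open_greaterThan)
  show thesis by (rule that[OF o]) (use u True in auto)
next
  case False
  then have s0: "s u = 0" using s_bounds[OF u] by simp
  obtain r where r: "r > 0" "ball u r \<subseteq> S" using open_S u openE by blast
  have "s x = 0" if x: "x \<in> ball u r" for x
  proof -
    let ?v = "x - u"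
    have inS: "u + t *\<^sub>R ?v \<in> S" if "0 \<le> t" "t \<le> 1" for t
    proof -
      have "u + t *\<^sub>R ?v \<in> closed_segment u x"
        using that by (auto simp: in_segment algebra_simps intro!: exI[of _ t])
      then show ?thesis using closed_segment_subset[of u "ball u r" x] x r by auto
    qed
    define h where "h t = s (u + t *\<^sub>R ?v)" for t
    define q where "q t = e \<bullet> D ?v (u + t *\<^sub>R ?v)" for t
    have h': "(h has_real_derivative - (2 / k) * (h t)\<^sup>2 * q t) (at t)" if "0 \<le> t" "t \<le> 1" for t
      using has_vector_derivative_line[OF diff_s[OF inS[OF that]]]
      unfolding h_def q_def has_real_derivative_iff_has_vector_derivative dirD_s[OF inS[OF that]] .
    have c: "continuous_on S (D ?v)" using smooth smooth_on_dirD smooth_on_continuous_on by blast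
    have "continuous_on {0..1} (\<lambda>t. D ?v (u + t *\<^sub>R ?v))"
    proof (rule continuous_on_compose2[OF c])
      show "continuous_on {0..1} (\<lambda>t. u + t *\<^sub>R ?v)" by (intro continuous_intros)
      show "(\<lambda>t. u + t *\<^sub>R ?v) ` {0..1} \<subseteq> S" using inS by fastforce
    qed
    then have "continuous_on {0..1} q"
      unfolding q_def[abs_def] by (rule continuous_on_inner[OF continuous_on_const])
    then have "bounded (q ` {0..1})" using compact_continuous_image compact_imp_bounded by blast
    then obtain M where M: "\<And>t. 0 \<le> t \<Longrightarrow> t \<le> 1 \<Longrightarrow> \<bar>q t\<bar> \<le> M"
      unfolding bounded_iff by fastforce
    \<comment> \<open>Since \<open>0 \<le> h \<le> k\<close>, the equation for \<open>h\<close> gives the linear inequality \<open>h' \<le> 2 M h\<close>.\<close>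
    have "h 1 * exp (- (2 * M) * 1) \<le> h 0 * exp (- (2 * M) * 0)"
    proof (rule DERIV_nonpos_imp_nonincreasing[of 0 1 "\<lambda>t. h t * exp (- (2 * M) * t)"])
      fix t :: real assume t: "0 \<le> t" "t \<le> 1"
      have d: "((\<lambda>t. h t * exp (- (2 * M) * t)) has_real_derivative
        (- (2 / k) * (h t)\<^sup>2 * q t - 2 * M * h t) * exp (- (2 * M) * t)) (at t)"
        by (rule derivative_eq_intros h' t refl)+ (simp add: algebra_simps)
      have hb: "0 \<le> h t" "h t \<le> k" using s_bounds[OF inS[OF t]] by (auto simp: h_def)
      have "- (2 / k) * (h t)\<^sup>2 * q t \<le> (2 / k) * (h t * h t) * M"
      proof -
        have "- q t \<le> M" using M[OF t] by simp
        then have "(2 / k) * (h t * h t) * (- q t) \<le> (2 / k) * (h t * h t) * M"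
          using k_pos by (intro mult_left_mono) auto
        then show ?thesis by (simp add: power2_eq_square)
      qed
      also have "\<dots> \<le> (2 / k) * (h t * k) * M"
        using hb k_pos M[OF t] by (intro mult_right_mono mult_left_mono) auto
      also have "\<dots> = 2 * M * h t" using k_pos by simp
      finally have "(- (2 / k) * (h t)\<^sup>2 * q t - 2 * M * h t) * exp (- (2 * M) * t) \<le> 0"
        by (intro mult_nonpos_nonneg) auto
      with d show "\<exists>y. ((\<lambda>t. h t * exp (- (2 * M) * t)) has_real_derivative y) (at t) \<and> y \<le> 0" by blast
    qed simp
    then have "h 1 * exp (- (2 * M)) \<le> 0" using s0 by (simp add: h_def)
    then have "h 1 \<le> 0" by (simp add: mult_le_0_iff)
    moreover have "0 \<le> h 1" using s_bounds[OF inS[of 1]] by (auto simp: h_def)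
    ultimately show ?thesis by (simp add: h_def)
  qed
  then show thesis using that[of "ball u r"] r s0 by auto
qed

lemma first_integrals_locally_constant:
  assumes u: "u \<in> S" and s: "\<And>x. x \<in> S \<Longrightarrow> s x > 0"
  obtains B where "open B" "u \<in> B" "B \<subseteq> S"
    "\<And>x. x \<in> B \<Longrightarrow> 1 / s x - (2 / k) * (e \<bullet> X x) = 1 / s u - (2 / k) * (e \<bullet> X u)"
    "\<And>x. x \<in> B \<Longrightarrow> (1 / s x) *\<^sub>R om (T e x) - om (X x) = (1 / s u) *\<^sub>R om (T e u) - om (X u)"
    "\<And>x. x \<in> B \<Longrightarrow> \<Theta> x * exp (\<i> * of_real (2 * (X x \<bullet> cJ e))) = \<Theta> u * exp (\<i> * of_real (2 * (X u \<bullet> cJ e)))"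
proof -
  obtain r where r: "r > 0" "ball u r \<subseteq> S" using open_S u openE by blast
  note const = zero_derivative_ball[OF r]
  show thesis
  proof (rule that[of "ball u r"])
    show "open (ball u r)" "u \<in> ball u r" "ball u r \<subseteq> S" using r by auto
    fix x assume x: "x \<in> ball u r"
    show "1 / s x - (2 / k) * (e \<bullet> X x) = 1 / s u - (2 / k) * (e \<bullet> X u)"
      by (rule const[OF first_integral_s[OF _ s] x])
    show "(1 / s x) *\<^sub>R om (T e x) - om (X x) = (1 / s u) *\<^sub>R om (T e u) - om (X u)"
      by (rule const[OF first_integral_om[OF _ s] x])
    show "\<Theta> x * exp (\<i> * of_real (2 * (X x \<bullet> cJ e))) = \<Theta> u * exp (\<i> * of_real (2 * (X u \<bullet> cJ e)))"
      by (rule const[OF first_integral_Theta x])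
  qed
qed

end

section \<open>Local injectivity of the immersion\<close>

context lagrangian_param
begin

text \<open>A left inverse of the derivative at \<open>u\<close> and continuity of the derivative in
  operator norm give injectivity nearby. That continuity follows from the continuity of the two
  partial derivatives.\<close>

lemma locally_injective:
  assumes u: "u \<in> S"
  obtains r where "r > 0" "ball u r \<subseteq> S" "inj_on X (ball u r)"
proof -
  have lin: "linear (\<lambda>v. D v u)" by (rule linear_dirD[OF diff_X[OF u]])
  have "inj (\<lambda>v. D v u)" using inj[OF u] by (simp add: dirD_def)
  then obtain g where g: "linear g" "g \<circ> (\<lambda>v. D v u) = id"
    using linear_injective_left_inverse[OF lin] by blast
  show thesis
  proof (rule has_derivative_locally_injective[where f' = "\<lambda>x v. D v x" and g' = g, OF u open_S _ g(2)])
    show "bounded_linear g" using g(1) linear_conv_bounded_linear by blast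
    show "(X has_derivative (\<lambda>v. D v x)) (at x)" if "x \<in> S" for x
      using has_derivative_dirD[OF diff_X[OF that]] .
    fix \<epsilon> :: real assume \<epsilon>: "\<epsilon> > 0"
    let ?d = "\<lambda>i x. D (axis i 1) x"
    have c: "continuous_on S (?d i)" for i
      using smooth smooth_on_dirD smooth_on_continuous_on by blast
    have "\<exists>d>0. \<forall>x. dist x u < d \<longrightarrow> dist (?d i x) (?d i u) < \<epsilon> / 3" for i
      using c[of i] u \<epsilon> unfolding continuous_on_eq_continuous_at[OF open_S] continuous_at_eps_delta
      by (metis divide_pos_pos zero_less_numeral)
    then obtain d where d: "\<And>i. d i > 0" "\<And>i x. dist x u < d i \<Longrightarrow> dist (?d i x) (?d i u) < \<epsilon> / 3"
      by metis
    obtain r where r: "r > 0" "ball u r \<subseteq> S" using open_S u openE by blast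
    have "onorm (\<lambda>v. D v x - D v u) < \<epsilon>" if x: "dist u x < min r (min (d 1) (d 2))" for x
    proof -
      have xS: "x \<in> S" using x r by auto
      have n: "norm (?d 1 x - ?d 1 u) < \<epsilon> / 3" "norm (?d 2 x - ?d 2 u) < \<epsilon> / 3"
        using d(2)[of x 1] d(2)[of x 2] x unfolding dist_norm[symmetric] by (auto simp: dist_commute)
      have "onorm (\<lambda>v. D v x - D v u) \<le> 2 * \<epsilon> / 3"
      proof (rule onorm_le)
        fix v
        have "D v x - D v u = (v $ 1) *\<^sub>R (?d 1 x - ?d 1 u) + (v $ 2) *\<^sub>R (?d 2 x - ?d 2 u)"
          unfolding D_decomp[OF xS, of v] D_decomp[OF u, of v] by (simp add: algebra_simps)
        then have "norm (D v x - D v u) \<le> \<bar>v $ 1\<bar> * norm (?d 1 x - ?d 1 u) + \<bar>v $ 2\<bar> * norm (?d 2 x - ?d 2 u)"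
          by (metis norm_triangle_ineq norm_scaleR)
        also have "\<dots> \<le> norm v * (\<epsilon> / 3) + norm v * (\<epsilon> / 3)"
          using n component_le_norm_cart[of v 1] component_le_norm_cart[of v 2]
          by (intro add_mono mult_mono) auto
        finally show "norm (D v x - D v u) \<le> 2 * \<epsilon> / 3 * norm v" by (simp add: algebra_simps)
      qed
      then show ?thesis using \<epsilon> by simp
    qed
    then show "\<exists>d>0. \<forall>x. dist u x < d \<longrightarrow> onorm (\<lambda>v. D v x - D v u) < \<epsilon>"
      using r d by (intro exI[of _ "min r (min (d 1) (d 2))"]) auto
  qed (use that in blast)
qed

end


section \<open>From charts to the surface\<close>

text \<open>All sets of the form \<open>{x \<in> topspace M. P (f x)}\<close> are open, so two
  different values would disconnect the space.\<close>

lemma connected_space_locally_constant: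
  assumes conn: "connected_space M"
    and loc: "\<And>m. m \<in> topspace M \<Longrightarrow> \<exists>U. openin M U \<and> m \<in> U \<and> (\<forall>m'\<in>U. f m' = f m)"
    and m: "m \<in> topspace M" "m' \<in> topspace M"
  shows "f m = f m'"
proof (rule ccontr)
  assume ne: "f m \<noteq> f m'"
  have op: "openin M {x \<in> topspace M. P (f x)}" for P
  proof (subst openin_subopen, intro ballI)
    fix x assume x: "x \<in> {x \<in> topspace M. P (f x)}"
    then obtain U where U: "openin M U" "x \<in> U" "\<forall>y\<in>U. f y = f x" using loc by blast
    have "U \<subseteq> {x \<in> topspace M. P (f x)}"
    proof
      fix y assume "y \<in> U"
      then have "y \<in> topspace M" "f y = f x" using openin_subset[OF U(1)] U(3) by blast+
      with x show "y \<in> {x \<in> topspace M. P (f x)}" by simp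
    qed
    with U show "\<exists>U. openin M U \<and> x \<in> U \<and> U \<subseteq> {x \<in> topspace M. P (f x)}" by blast
  qed
  have "topspace M \<subseteq> {x \<in> topspace M. f x = f m} \<union> {x \<in> topspace M. f x \<noteq> f m}" by blast
  moreover have "{x \<in> topspace M. f x = f m} \<inter> {x \<in> topspace M. f x \<noteq> f m} = {}" by blast
  moreover have "m \<in> {x \<in> topspace M. f x = f m}" "m' \<in> {x \<in> topspace M. f x \<noteq> f m}"
    using m ne by auto
  ultimately show False
    using conn op[of "\<lambda>y. y = f m"] op[of "\<lambda>y. y \<noteq> f m"] unfolding connected_space_def by blast
qed

section \<open>Passing from functions on charts to functions on the surface\<close>

locale surface =
  fixes M :: "'a topology" and \<A> :: "'a chart set"
  assumes surf: "connected_smooth_surface M \<A>"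
begin

lemma chart:
  assumes "c \<in> \<A>"
  shows "openin M (fst c)" "open (coords c)"
    "homeomorphic_map (subtopology M (fst c)) (top_of_set (coords c)) (snd c)"
  using assms surf unfolding connected_smooth_surface_def smooth_atlas_def coords_def by auto

lemma topspace_chart: "c \<in> \<A> \<Longrightarrow> topspace (subtopology M (fst c)) = fst c"
  using openin_subset[OF chart(1)] by (simp add: Int_absorb1)

lemma transition: "c \<in> \<A> \<Longrightarrow> d \<in> \<A> \<Longrightarrow>
    smooth_on (snd d \<circ> inv_into (fst c) (snd c)) (snd c ` (fst c \<inter> fst d))"
  using surf unfolding connected_smooth_surface_def smooth_atlas_def
  by (auto simp: split_beta)

lemma covered: "m \<in> topspace M \<Longrightarrow> \<exists>c\<in>\<A>. m \<in> fst c"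
proof -
  assume m: "m \<in> topspace M"
  have "(\<Union>(U, x)\<in>\<A>. U) = topspace M"
    using surf unfolding connected_smooth_surface_def smooth_atlas_def by blast
  with m have "m \<in> (\<Union>(U, x)\<in>\<A>. U)" by blast
  then show "\<exists>c\<in>\<A>. m \<in> fst c" by (auto simp: split_beta)
qed

lemma chart_inj: "c \<in> \<A> \<Longrightarrow> inj_on (snd c) (fst c)"
  using homeomorphic_imp_injective_map[OF chart(3)] topspace_chart by metis

lemma inv_chart: "c \<in> \<A> \<Longrightarrow> m \<in> fst c \<Longrightarrow> inv_into (fst c) (snd c) (snd c m) = m"
  using chart_inj by simp

lemma openin_chart_preimage:
  assumes c: "c \<in> \<A>" and B: "open B"
  shows "openin M {m \<in> fst c. snd c m \<in> B}"
proof -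
  have "continuous_map (subtopology M (fst c)) euclidean (snd c)"
    using homeomorphic_imp_continuous_map[OF chart(3)[OF c]] continuous_map_into_fulltopology by blast
  then have "openin (subtopology M (fst c)) {m \<in> topspace (subtopology M (fst c)). snd c m \<in> B}"
    by (rule openin_continuous_map_preimage) (use B in simp)
  then show ?thesis unfolding topspace_chart[OF c] using chart(1)[OF c] openin_trans_full by blast
qed

lemma open_overlap:
  assumes c: "c \<in> \<A>" and d: "d \<in> \<A>"
  shows "open (snd c ` (fst c \<inter> fst d))"
proof -
  have "openin (subtopology M (fst c)) (fst c \<inter> fst d)"
    using chart(1)[OF d] by (metis openin_subtopology inf_commute)
  then have "openin (top_of_set (coords c)) (snd c ` (fst c \<inter> fst d))"
    using homeomorphic_imp_open_map[OF chart(3)[OF c]] unfolding open_map_def by blast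
  then show ?thesis using chart(2)[OF c] openin_open_eq by blast
qed

text \<open>Functions on charts that agree on overlaps descend to a locally constant function
  \<open>g\<close> on the connected surface. The value type is arbitrary because the lemma serves
  both for the truth value \<open>s > 0\<close> and for the triple of first integrals.\<close>

lemma chart_function_constant:
  fixes f :: "'a chart \<Rightarrow> real^2 \<Rightarrow> 'b"
  assumes indep: "\<And>c d m. c \<in> \<A> \<Longrightarrow> d \<in> \<A> \<Longrightarrow> m \<in> fst c \<Longrightarrow> m \<in> fst d \<Longrightarrow> f c (snd c m) = f d (snd d m)"
    and loc: "\<And>c u. c \<in> \<A> \<Longrightarrow> u \<in> coords c \<Longrightarrow> \<exists>B. open B \<and> u \<in> B \<and> B \<subseteq> coords c \<and> (\<forall>x\<in>B. f c x = f c u)"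
  shows "\<exists>y. \<forall>c\<in>\<A>. \<forall>u\<in>coords c. f c u = y"
proof (cases "topspace M = {}")
  \<comment> \<open>All chart domains are empty, so any value serves.\<close>
  case True
  have "fst c = {}" if "c \<in> \<A>" for c using chart(1)[OF that] openin_subset True by blast
  then show ?thesis by (auto simp: coords_def)
next
  case False
  then obtain m0 where m0: "m0 \<in> topspace M" by blast
  define g where "g m = (let c = SOME c. c \<in> \<A> \<and> m \<in> fst c in f c (snd c m))" for m
  have g: "g m = f c (snd c m)" if c: "c \<in> \<A>" "m \<in> fst c" for c m
  proof -
    let ?c = "SOME c. c \<in> \<A> \<and> m \<in> fst c"
    have "?c \<in> \<A> \<and> m \<in> fst ?c" by (rule someI[of _ c]) (use c in simp)
    then show ?thesis unfolding g_def Let_def using indep[of ?c c m] c by blast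
  qed
  have "\<exists>U. openin M U \<and> m \<in> U \<and> (\<forall>m'\<in>U. g m' = g m)" if m: "m \<in> topspace M" for m
  proof -
    obtain c where c: "c \<in> \<A>" "m \<in> fst c" using covered[OF m] by blast
    obtain B where B: "open B" "snd c m \<in> B" "\<forall>x\<in>B. f c x = f c (snd c m)"
      using loc[OF c(1), of "snd c m"] c(2) by (auto simp: coords_def)
    have "g m' = g m" if "m' \<in> {m \<in> fst c. snd c m \<in> B}" for m'
    proof -
      have m': "m' \<in> fst c" "snd c m' \<in> B" using that by auto
      show ?thesis unfolding g[OF c(1) m'(1)] g[OF c] using B(3) m'(2) by blast
    qed
    with openin_chart_preimage[OF c(1) B(1)] c(2) B(2) show ?thesis
      by (intro exI[of _ "{m \<in> fst c. snd c m \<in> B}"]) blast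
  qed
  moreover have "connected_space M" using surf unfolding connected_smooth_surface_def by blast
  ultimately have const: "g m = g m0" if "m \<in> topspace M" for m
    using connected_space_locally_constant[of M g] that m0 by blast
  have "f c u = g m0" if c: "c \<in> \<A>" and u: "u \<in> coords c" for c u
  proof -
    obtain m where m: "m \<in> fst c" "u = snd c m" using u by (auto simp: coords_def)
    have "m \<in> topspace M" using m chart(1)[OF c] openin_subset by blast
    then show ?thesis using const g[OF c m(1)] m(2) by simp
  qed
  then show ?thesis by blast
qed

text \<open>The chain rule through the transition map; exchanging the charts gives equality.\<close>

lemma tangent_plane_subset:
  assumes smooth: "\<And>c. c \<in> \<A> \<Longrightarrow> smooth_on (local_param \<phi> c) (coords c)"
    and c: "c \<in> \<A>" "m \<in> fst c" and d: "d \<in> \<A>" "m \<in> fst d"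
  shows "tangent_plane (local_param \<phi> c) (snd c m) \<subseteq> tangent_plane (local_param \<phi> d) (snd d m)"
proof -
  let ?\<tau> = "snd d \<circ> inv_into (fst c) (snd c)"
  let ?V = "snd c ` (fst c \<inter> fst d)"
  have m: "snd c m \<in> ?V" using c d by blast
  have t: "?\<tau> differentiable (at (snd c m))"
    using smooth_on_differentiable[OF transition[OF c(1) d(1)] m] .
  have tm: "?\<tau> (snd c m) = snd d m" using inv_chart[OF c] by simp
  have dd: "local_param \<phi> d differentiable (at (?\<tau> (snd c m)))"
    unfolding tm using smooth_on_differentiable[OF smooth[OF d(1)]] d(2) by (simp add: coords_def)
  have cc: "local_param \<phi> c differentiable (at (snd c m))"
    using smooth_on_differentiable[OF smooth[OF c(1)]] c(2) by (simp add: coords_def)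
  have eq: "local_param \<phi> c x = (local_param \<phi> d \<circ> ?\<tau>) x" if "x \<in> ?V" for x
    using that inv_chart[OF c(1)] inv_chart[OF d(1)] by (auto simp: local_param_def)
  have "frechet_derivative (local_param \<phi> c) (at (snd c m)) = frechet_derivative (local_param \<phi> d \<circ> ?\<tau>) (at (snd c m))"
    by (rule frechet_derivative_transform_within_open[OF cc open_overlap[OF c(1) d(1)] m eq])
  also have "\<dots> = frechet_derivative (local_param \<phi> d) (at (snd d m)) \<circ> frechet_derivative ?\<tau> (at (snd c m))"
    using frechet_derivative_compose[OF t dd] unfolding tm .
  finally show ?thesis unfolding tangent_plane_def by auto
qed

end

section \<open>Constants of the soliton on the whole surface\<close>

locale soliton_surface = surface +
  fixes \<phi> :: "'a \<Rightarrow> complex \<times> complex" and e :: "complex \<times> complex"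
  assumes imm: "immersion \<A> \<phi>" and lag: "lagrangian \<A> \<phi>" and ham: "hamiltonian_stationary \<A> \<phi>"
    and not_tg: "\<not> totally_geodesic \<A> \<phi>" and e_nz: "e \<noteq> 0"
    and sol: "\<And>c u. c \<in> \<A> \<Longrightarrow> u \<in> coords c \<Longrightarrow>
      mean_curvature (local_param \<phi> c) u = normal_part (local_param \<phi> c) u e"
begin

lemma param: assumes c: "c \<in> \<A>" shows "soliton_param (local_param \<phi> c) (coords c) e"
proof
  show "open (coords c)" by (rule chart(2)[OF c])
  show "smooth_on (local_param \<phi> c) (coords c)" using imm c unfolding immersion_def by blast
  show "inj (frechet_derivative (local_param \<phi> c) (at u))" if "u \<in> coords c" for u
    using imm c that unfolding immersion_def by blast
  show "kaehler_form (dirD (local_param \<phi> c) v u) (dirD (local_param \<phi> c) w u) = 0" if "u \<in> coords c" for u v w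
    using lag c that unfolding lagrangian_def dirD_def by blast
  show "e \<noteq> 0" by (rule e_nz)
  show "mean_curvature (local_param \<phi> c) u = normal_part (local_param \<phi> c) u e" if "u \<in> coords c" for u
    by (rule sol[OF c that])
  show "\<exists>W \<beta>. open W \<and> u \<in> W \<and> W \<subseteq> coords c \<and> lagrangian_angle_on (local_param \<phi> c) \<beta> W \<and>
    (\<forall>v\<in>W. laplacian (local_param \<phi> c) \<beta> v = 0)" if "u \<in> coords c" for u
    using ham c that unfolding hamiltonian_stationary_def by blast
qed

lemma lparam: "c \<in> \<A> \<Longrightarrow> lagrangian_param (local_param \<phi> c) (coords c)"
  using param soliton_param.axioms(1) by blast

abbreviation "Tc c \<equiv> lagrangian_param.T (local_param \<phi> c) e"
abbreviation "Thc c \<equiv> lagrangian_param.\<Theta> (local_param \<phi> c)"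
abbreviation "sc c \<equiv> soliton_param.s (local_param \<phi> c) e"
abbreviation "ke \<equiv> soliton_param.k e"
abbreviation "ome \<equiv> soliton_param.om e"

lemma s_eq: "c \<in> \<A> \<Longrightarrow> sc c u = ke - Tc c u \<bullet> Tc c u"
  using soliton_param.s_def[OF param] .

lemma local_param_chart: "c \<in> \<A> \<Longrightarrow> m \<in> fst c \<Longrightarrow> local_param \<phi> c (snd c m) = \<phi> m"
  using inv_chart by (simp add: local_param_def)

lemma chart_mem: "m \<in> fst c \<Longrightarrow> snd c m \<in> coords c"
  by (simp add: coords_def)

text \<open>The tangential part of \<open>e\<close>, and with it \<open>s\<close>, depends only on
  the tangent plane, which the charts share; \<open>\<Theta>\<close> is evaluated by
  \<open>Theta_eq\<close> on one orthonormal basis of this plane.\<close>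

lemma chart_independent:
  assumes c: "c \<in> \<A>" "m \<in> fst c" and d: "d \<in> \<A>" "m \<in> fst d"
  shows "Tc c (snd c m) = Tc d (snd d m)" "Thc c (snd c m) = Thc d (snd d m)"
    "sc c (snd c m) = sc d (snd d m)"
proof -
  interpret C: soliton_param "local_param \<phi> c" "coords c" e by (rule param[OF c(1)])
  interpret D: soliton_param "local_param \<phi> d" "coords d" e by (rule param[OF d(1)])
  have smooth: "smooth_on (local_param \<phi> c) (coords c)" if "c \<in> \<A>" for c
    using lagrangian_param.smooth[OF lparam[OF that]] .
  have tp: "tangent_plane (local_param \<phi> c) (snd c m) = tangent_plane (local_param \<phi> d) (snd d m)"
    using tangent_plane_subset[OF smooth c d] tangent_plane_subset[OF smooth d c] by blast
  have uc: "snd c m \<in> coords c" and ud: "snd d m \<in> coords d" by (rule chart_mem[OF c(2)], rule chart_mem[OF d(2)])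
  have "normal_part (local_param \<phi> c) (snd c m) e = normal_part (local_param \<phi> d) (snd d m) e"
    unfolding normal_part_def tp ..
  then show T: "Tc c (snd c m) = Tc d (snd d m)"
    unfolding C.normal_part_eq[OF uc] D.normal_part_eq[OF ud] by simp
  then show "sc c (snd c m) = sc d (snd d m)" unfolding C.s_def D.s_def by simp
  obtain a b where ab: "C.D a (snd c m) \<bullet> C.D a (snd c m) = 1" "C.D b (snd c m) \<bullet> C.D b (snd c m) = 1"
    "C.D a (snd c m) \<bullet> C.D b (snd c m) = 0"
    using C.orthonormal_frame[OF uc] .
  have mem: "C.D v (snd c m) \<in> tangent_plane (local_param \<phi> c) (snd c m)" for v
    unfolding C.tangent_plane_eq by blast
  show "Thc c (snd c m) = Thc d (snd d m)"
    unfolding C.Theta_eq[OF uc mem mem ab] D.Theta_eq[OF ud mem[unfolded tp] mem[unfolded tp] ab] ..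
qed

text \<open>At a point with nonzero second fundamental form \<open>s\<close> is positive by
  \<open>second_ff_zero\<close>, and the truth value of \<open>s > 0\<close> is the same on the
  whole connected surface.\<close>

lemma s_pos: assumes "c \<in> \<A>" "u \<in> coords c" shows "sc c u > 0"
proof -
  have "\<exists>y. \<forall>c\<in>\<A>. \<forall>u\<in>coords c. (sc c u > 0) = y"
  proof (rule chart_function_constant)
    show "(sc c (snd c m) > 0) = (sc d (snd d m) > 0)"
      if "c \<in> \<A>" "d \<in> \<A>" "m \<in> fst c" "m \<in> fst d" for c d m
      using chart_independent(3)[of c m d] that by simp
    show "\<exists>B. open B \<and> u \<in> B \<and> B \<subseteq> coords c \<and> (\<forall>x\<in>B. (sc c x > 0) = (sc c u > 0))"
      if c: "c \<in> \<A>" and u: "u \<in> coords c" for c u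
    proof -
      obtain B where "open B" "u \<in> B" "B \<subseteq> coords c" "\<And>x. x \<in> B \<Longrightarrow> (sc c x > 0) = (sc c u > 0)"
        by (rule soliton_param.s_sign_locally_constant[OF param[OF c] u]) blast
      then show ?thesis by (intro exI[of _ B] conjI ballI)
    qed
  qed
  then obtain y where y: "\<And>c u. c \<in> \<A> \<Longrightarrow> u \<in> coords c \<Longrightarrow> (sc c u > 0) = y" by blast
  obtain c' u' i j where c': "c' \<in> \<A>" "u' \<in> coords c'" "second_ff (local_param \<phi> c') i j u' \<noteq> 0"
    using not_tg unfolding totally_geodesic_def by blast
  have "sc c' u' \<noteq> 0" using soliton_param.second_ff_zero[OF param[OF c'(1)] c'(2)] c'(3) by blast
  then have "sc c' u' > 0" using soliton_param.s_bounds(1)[OF param[OF c'(1)] c'(2)] by simp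
  then show ?thesis using y assms c' by blast
qed

lemma first_integrals:
  obtains A w0 \<theta> where "\<And>c u. c \<in> \<A> \<Longrightarrow> u \<in> coords c \<Longrightarrow>
     1 / sc c u - (2 / ke) * (e \<bullet> local_param \<phi> c u) = A \<and>
     (1 / sc c u) *\<^sub>R ome (Tc c u) - ome (local_param \<phi> c u) = w0 \<and>
     Thc c u * exp (\<i> * of_real (2 * (local_param \<phi> c u \<bullet> cJ e))) = \<theta>"
proof -
  \<comment> \<open>Bundling the three integrals in a triple lets one appeal to
    \<open>chart_function_constant\<close> settle all of them.\<close>
  let ?f = "\<lambda>c u. (1 / sc c u - (2 / ke) * (e \<bullet> local_param \<phi> c u),
     (1 / sc c u) *\<^sub>R ome (Tc c u) - ome (local_param \<phi> c u),
     Thc c u * exp (\<i> * of_real (2 * (local_param \<phi> c u \<bullet> cJ e))))"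
  have "\<exists>y. \<forall>c\<in>\<A>. \<forall>u\<in>coords c. ?f c u = y"
  proof (rule chart_function_constant)
    show "?f c (snd c m) = ?f d (snd d m)"
      if "c \<in> \<A>" "d \<in> \<A>" "m \<in> fst c" "m \<in> fst d" for c d m
      using chart_independent[OF that(1,3,2,4)] local_param_chart[OF that(1,3)] local_param_chart[OF that(2,4)]
      by simp
    show "\<exists>B. open B \<and> u \<in> B \<and> B \<subseteq> coords c \<and> (\<forall>x\<in>B. ?f c x = ?f c u)"
      if c: "c \<in> \<A>" and u: "u \<in> coords c" for c u
    proof (rule soliton_param.first_integrals_locally_constant[OF param[OF c] u s_pos[OF c]])
      fix B assume B: "open B" "u \<in> B" "B \<subseteq> coords c"
        "\<And>x. x \<in> B \<Longrightarrow> 1 / sc c x - (2 / ke) * (e \<bullet> local_param \<phi> c x) = 1 / sc c u - (2 / ke) * (e \<bullet> local_param \<phi> c u)"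
        "\<And>x. x \<in> B \<Longrightarrow> (1 / sc c x) *\<^sub>R ome (Tc c x) - ome (local_param \<phi> c x)
          = (1 / sc c u) *\<^sub>R ome (Tc c u) - ome (local_param \<phi> c u)"
        "\<And>x. x \<in> B \<Longrightarrow> Thc c x * exp (\<i> * of_real (2 * (local_param \<phi> c x \<bullet> cJ e)))
          = Thc c u * exp (\<i> * of_real (2 * (local_param \<phi> c u \<bullet> cJ e)))"
      show ?thesis
      proof (intro exI[of _ B] conjI ballI B(1-3))
        fix x assume x: "x \<in> B"
        show "?f c x = ?f c u" unfolding B(4)[OF x] B(5)[OF x] B(6)[OF x] ..
      qed
    qed
  qed
  then obtain y where y: "\<And>c u. c \<in> \<A> \<Longrightarrow> u \<in> coords c \<Longrightarrow> ?f c u = y" by blast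
  show thesis
    by (rule that[of "fst y" "fst (snd y)" "snd (snd y)"]) (use y in \<open>metis fst_conv snd_conv\<close>)
qed

end

section \<open>Unitary coordinates and the model surface\<close>

lemma herm_Lagrange: "(cmod (herm q e))\<^sup>2 + (cmod (dz1_dz2 e q))\<^sup>2 = (e \<bullet> e) * (q \<bullet> q)"
  unfolding cmod_power2
  by (simp add: herm_eq dz1_dz2_def inner_prod_def inner_complex_def power2_eq_square algebra_simps)

lemma norm_prod_sq: "(norm (p :: complex \<times> complex))\<^sup>2 = (cmod (fst p))\<^sup>2 + (cmod (snd p))\<^sup>2"
  by (simp add: norm_prod_def)

text \<open>Up to the scaling by the length of \<open>e\<close>, the pair (\<open>herm p e\<close>, \<open>dz1_dz2 e p\<close>) gives the coordinates
  of \<open>p\<close> in a unitary basis whose first vector is a multiple of \<open>e\<close>.\<close>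
lemma adapted_similarity:
  assumes e: "e \<noteq> 0" and mu: "cmod \<mu> = 1"
  obtains Dl R where "dilation Dl" "rigid_motion R"
    "\<And>p. R (Dl p) = (herm p e + b1, \<mu> * dz1_dz2 e p + b2)"
proof -
  define r where "r = norm e"
  have r: "r > 0" using e by (simp add: r_def)
  \<comment> \<open>Division by \<open>r\<close> makes \<open>U\<close> an isometry by
    \<open>herm_Lagrange\<close>, and the dilation by \<open>r\<close> restores the scale. Both
    components are complex linear in \<open>q\<close>, so \<open>U\<close> commutes with
    \<open>cJ\<close>.\<close>
  define U where "U q = (1 / r) *\<^sub>R (herm q e, \<mu> * dz1_dz2 e q)" for q
  have lin: "linear U"
    by (auto simp: linear_iff U_def herm_eq dz1_dz2_def scaleR_conv_of_real algebra_simps)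
  have "norm (U q) = norm q" for q
  proof -
    have "(norm (U q))\<^sup>2 = (1 / r)\<^sup>2 * ((cmod (herm q e))\<^sup>2 + (cmod (dz1_dz2 e q))\<^sup>2)"
      unfolding norm_prod_sq U_def by (simp add: norm_mult mu power_mult_distrib power_divide add_divide_distrib)
    also have "\<dots> = (1 / r)\<^sup>2 * (r\<^sup>2 * (norm q)\<^sup>2)"
      unfolding herm_Lagrange r_def by (simp add: power2_norm_eq_inner)
    also have "\<dots> = (norm q)\<^sup>2" using r by (simp add: power_divide)
    finally show ?thesis by simp
  qed
  then have U: "orthogonal_transformation U" using lin orthogonal_transformation by blast
  have UJ: "U (cJ q) = cJ (U q)" for q
    by (simp add: U_def herm_eq dz1_dz2_def cJ_def scaleR_conv_of_real algebra_simps)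
  show thesis
  proof (rule that[of "\<lambda>p. r *\<^sub>R p" "\<lambda>p. U p + (b1, b2)"])
    show "dilation (\<lambda>p. r *\<^sub>R p)" unfolding dilation_def using r by blast
    show "rigid_motion (\<lambda>p. U p + (b1, b2))" unfolding rigid_motion_def using U UJ by blast
    show "U (r *\<^sub>R p) + (b1, b2) = (herm p e + b1, \<mu> * dz1_dz2 e p + b2)" for p
      unfolding linear_scale[OF lin] using r by (simp add: U_def)
  qed
qed

text \<open>The model is parametrized by \<open>(q, f) \<mapsto> (q\<^sup>2 / 2 + \<i> f, q exp (- \<i> f))\<close>; the following
  map recovers \<open>q + \<i> f\<close>.\<close>
definition model_chart :: "complex \<times> complex \<Rightarrow> complex" where
  "model_chart p = Complex (Re (snd p * exp (\<i> * of_real (Im (fst p))))) (Im (fst p))"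

lemma continuous_on_model_chart: "continuous_on S model_chart"
  unfolding model_chart_def[abs_def] Complex_eq by (intro continuous_intros)

text \<open>At a point \<open>(z, w)\<close> of the model, \<open>w\<close> times the exponential of
  \<open>\<i>\<close> times \<open>Im z\<close> has the nonnegative square \<open>2 * Re z\<close>.
  It is therefore real, so taking its real part loses nothing, and its square recovers
  \<open>Re z\<close>.\<close>

lemma inj_on_model_chart: "inj_on model_chart model_soliton"
proof (rule inj_onI)
  have real: "snd p * exp (\<i> * of_real (Im (fst p))) = of_real (Re (model_chart p))"
    and Re_eq: "2 * Re (fst p) = (Re (model_chart p))\<^sup>2" if "p \<in> model_soliton" for p
  proof -
    let ?x = "snd p * exp (\<i> * of_real (Im (fst p)))"
    have p: "(snd p)\<^sup>2 = of_real (2 * Re (fst p)) * exp (- 2 * \<i> * of_real (Im (fst p)))" "Re (fst p) \<ge> 0"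
      using that by (auto simp: model_soliton_def)
    have "?x\<^sup>2 = (snd p)\<^sup>2 * exp (2 * \<i> * of_real (Im (fst p)))"
      by (simp add: power_mult_distrib exp_double[symmetric] mult.assoc)
    also have "\<dots> = of_real (2 * Re (fst p))" unfolding p(1) by (simp add: mult.assoc exp_add[symmetric])
    finally have sq: "?x\<^sup>2 = of_real (2 * Re (fst p))" .
    have "?x\<^sup>2 = (of_real (sqrt (2 * Re (fst p))))\<^sup>2"
      unfolding sq using p(2) by (simp flip: of_real_power)
    then have "?x = of_real (sqrt (2 * Re (fst p))) \<or> ?x = - of_real (sqrt (2 * Re (fst p)))"
      by (simp add: power2_eq_iff)
    then have "Im ?x = 0" by (metis Im_complex_of_real minus_zero uminus_complex.sel(2))
    then show 1: "?x = of_real (Re (model_chart p))" by (simp add: complex_eq_iff model_chart_def)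
    have "of_real ((Re (model_chart p))\<^sup>2) = (of_real (2 * Re (fst p)) :: complex)"
      using sq unfolding 1 by simp
    then show "2 * Re (fst p) = (Re (model_chart p))\<^sup>2" using of_real_eq_iff by metis
  qed
  fix p q assume p: "p \<in> model_soliton" and q: "q \<in> model_soliton" and eq: "model_chart p = model_chart q"
  have Im: "Im (fst p) = Im (fst q)" using arg_cong[OF eq, of Im] by (simp add: model_chart_def)
  have "2 * Re (fst p) = 2 * Re (fst q)" unfolding Re_eq[OF p] Re_eq[OF q] eq ..
  then have f: "fst p = fst q" using Im by (simp add: complex_eq_iff)
  have "snd p * exp (\<i> * of_real (Im (fst p))) = snd q * exp (\<i> * of_real (Im (fst p)))"
    using real[OF p] real[OF q] eq Im by simp
  then have "snd p = snd q" by simp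
  with f show "p = q" by (simp add: prod_eq_iff)
qed

text \<open>After composition with \<open>model_chart\<close> this is a continuous injection between
  spaces of real dimension 2, with open image by invariance of domain; injectivity of
  \<open>model_chart\<close> on the model pulls openness back.\<close>

lemma openin_model_image:
  fixes f :: "real^2 \<Rightarrow> complex \<times> complex"
  assumes "open B" "continuous_on B f" "inj_on f B" "f ` B \<subseteq> model_soliton"
  shows "openin (top_of_set model_soliton) (f ` B)"
proof -
  have "inj_on (model_chart \<circ> f) B"
    using assms(3,4) inj_on_model_chart by (intro comp_inj_on) (auto intro: inj_on_subset)
  moreover have "continuous_on B (model_chart \<circ> f)"
    using assms(2) continuous_on_model_chart by (rule continuous_on_compose)
  ultimately have o: "open ((model_chart \<circ> f) ` B)"
    using assms(1) by (intro invariance_of_domain_gen) auto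
  have "f ` B = model_soliton \<inter> model_chart -` ((model_chart \<circ> f) ` B)"
    using assms(4) inj_on_model_chart by (auto simp: inj_on_def subset_eq image_iff)
  moreover have "open (model_chart -` ((model_chart \<circ> f) ` B))"
    using continuous_on_open_vimage[OF open_UNIV, of model_chart] continuous_on_model_chart o by auto
  ultimately show ?thesis unfolding openin_open by metis
qed

section \<open>The image of the surface in the model\<close>

context soliton_surface
begin

lemma Theta_norm:
  assumes c: "c \<in> \<A>" and u: "u \<in> coords c" shows "cmod (Thc c u) = 1"
proof -
  interpret soliton_param "local_param \<phi> c" "coords c" e by (rule param[OF c])
  have g: "gdet u > 0" by (rule gdet_pos[OF u])
  have "cmod (\<Omega> u * cnj (\<Omega> u)) = gdet u" unfolding Omega_norm[OF u] using g by simp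
  then have "cmod (\<Omega> u) * cmod (\<Omega> u) = gdet u" by (simp add: norm_mult)
  then show ?thesis using g by (simp add: \<Theta>_def norm_divide norm_mult power2_eq_square)
qed

text \<open>The three constants dictate the similarity: \<open>A\<close> fixes the translation of
  the first coordinate, \<open>\<theta>\<close> the phase of the second, and \<open>w0\<close> with
  this phase the translation of the second.\<close>

lemma image_in_model:
  obtains Dl R where "dilation Dl" "rigid_motion R" "continuous_on UNIV (R \<circ> Dl)" "inj (R \<circ> Dl)"
    "\<And>c u. c \<in> \<A> \<Longrightarrow> u \<in> coords c \<Longrightarrow> R (Dl (local_param \<phi> c u)) \<in> model_soliton"
proof -
  obtain A w0 \<theta> where fi: "\<And>c u. c \<in> \<A> \<Longrightarrow> u \<in> coords c \<Longrightarrow>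
     1 / sc c u - (2 / ke) * (e \<bullet> local_param \<phi> c u) = A \<and>
     (1 / sc c u) *\<^sub>R ome (Tc c u) - ome (local_param \<phi> c u) = w0 \<and>
     Thc c u * exp (\<i> * of_real (2 * (local_param \<phi> c u \<bullet> cJ e))) = \<theta>"
    using first_integrals by blast
  obtain c0 u0 where c0: "c0 \<in> \<A>" "u0 \<in> coords c0"
    using not_tg unfolding totally_geodesic_def by blast
  have th: "cmod \<theta> = 1"
    using fi[OF c0] Theta_norm[OF c0] by (metis norm_exp_i_times norm_mult mult_1)
  \<comment> \<open>Chosen so that \<open>\<mu>\<^sup>2 * \<theta> = - 1\<close>, which cancels both
    the constant of the third integral and the sign in \<open>om_T\<close>.\<close>
  define \<mu> where "\<mu> = csqrt (- 1 / \<theta>)"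
  have mu2: "\<mu>\<^sup>2 * \<theta> = - 1" using th unfolding \<mu>_def by auto
  have "(cmod \<mu>)\<^sup>2 = 1" using arg_cong[OF mu2, of cmod] th by (simp add: norm_mult norm_power)
  then have mu: "cmod \<mu> = 1" by (simp add: power2_eq_1_iff) (use norm_ge_zero[of \<mu>] in linarith)
  \<comment> \<open>With this shift the first integral says that \<open>ke / s - 1\<close> is twice
    the real part of the first coordinate, and \<open>s \<le> ke\<close> makes that real part
    nonnegative.\<close>
  define g0 where "g0 = (1 - ke * A) / 2"
  obtain Dl R where DR: "dilation Dl" "rigid_motion R"
    and eq: "\<And>p. R (Dl p) = (herm p e + (- of_real g0), \<mu> * dz1_dz2 e p + \<mu> * w0)"
    using adapted_similarity[OF e_nz mu] by metis
  have cont: "continuous_on UNIV (R \<circ> Dl)"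
    unfolding o_def eq herm_eq dz1_dz2_def by (intro continuous_intros)
  have inj: "inj (R \<circ> Dl)"
  proof -
    obtain U b where U: "orthogonal_transformation U" "R = (\<lambda>p. U p + b)"
      using DR(2) unfolding rigid_motion_def by blast
    obtain r where r: "r > 0" "Dl = (\<lambda>p. r *\<^sub>R p)" using DR(1) unfolding dilation_def by blast
    show ?thesis
    proof (rule injI)
      fix p q assume "(R \<circ> Dl) p = (R \<circ> Dl) q"
      then have "U (r *\<^sub>R p) = U (r *\<^sub>R q)" by (simp add: U(2) r(2))
      then have "r *\<^sub>R p = r *\<^sub>R q" by (rule injD[OF orthogonal_transformation_inj[OF U(1)]])
      then show "p = q" using r(1) by simp
    qed
  qed
  have "R (Dl (local_param \<phi> c u)) \<in> model_soliton" if c: "c \<in> \<A>" and u: "u \<in> coords c" for c u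
  proof -
    interpret soliton_param "local_param \<phi> c" "coords c" e by (rule param[OF c])
    let ?X = "local_param \<phi> c u"
    let ?g = "e \<bullet> ?X" and ?f = "?X \<bullet> cJ e" and ?s = "sc c u"
    have s: "?s > 0" "?s \<le> ke" using s_pos[OF c u] s_bounds(2)[OF u] by auto
    have kp: "ke > 0" by (rule k_pos)
    have 1: "ke / ?s - 1 = 2 * (?g - g0)"
    proof -
      have "1 / ?s = A + (2 / ke) * ?g" using fi[OF c u] by simp
      then have "ke * (1 / ?s) = ke * A + 2 * ?g" using kp by (simp add: algebra_simps)
      moreover have "2 * g0 = 1 - ke * A" by (simp add: g0_def)
      ultimately show ?thesis by simp
    qed
    have 2: "ome ?X + w0 = (1 / ?s) *\<^sub>R ome (Tc c u)" using fi[OF c u] by auto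
    have 3: "Thc c u = \<theta> * exp (- (\<i> * of_real (2 * ?f)))"
    proof -
      have "\<theta> * exp (- (\<i> * of_real (2 * ?f))) = Thc c u * (exp (\<i> * of_real (2 * ?f)) * exp (- (\<i> * of_real (2 * ?f))))"
        using fi[OF c u] by (simp add: mult.assoc)
      then show ?thesis by (simp add: exp_add[symmetric])
    qed
    have fst: "fst (R (Dl ?X)) = Complex (?g - g0) ?f"
      unfolding eq herm_def by (simp add: complex_eq_iff inner_commute)
    have "snd (R (Dl ?X)) = \<mu> * (ome ?X + w0)"
      unfolding eq by (simp add: om_def algebra_simps)
    then have "(snd (R (Dl ?X)))\<^sup>2 = \<mu>\<^sup>2 * (of_real ((1 / ?s)\<^sup>2) * (ome (Tc c u))\<^sup>2)"
      unfolding 2 by (simp add: scaleR_conv_of_real power_mult_distrib power_divide)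
    also have "\<dots> = (\<mu>\<^sup>2 * \<theta>) * (- of_real ((1 / ?s)\<^sup>2 * (?s * (ke - ?s)))) * exp (- (\<i> * of_real (2 * ?f)))"
      unfolding om_T[OF u] 3 by (simp add: algebra_simps)
    also have "(1 / ?s)\<^sup>2 * (?s * (ke - ?s)) = 2 * (?g - g0)"
      unfolding 1[symmetric] using s by (simp add: power2_eq_square field_simps)
    finally have snd: "(snd (R (Dl ?X)))\<^sup>2 = of_real (2 * (?g - g0)) * exp (- (\<i> * of_real (2 * ?f)))"
      unfolding mu2 by simp
    have "ke / ?s \<ge> 1" using s by simp
    then have "?g - g0 \<ge> 0" using 1 by simp
    then have "(fst (R (Dl ?X)), snd (R (Dl ?X))) \<in> model_soliton"
      unfolding model_soliton_def using snd fst by (simp add: algebra_simps)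
    then show ?thesis by simp
  qed
  with DR cont inj show thesis by (rule that)
qed

text \<open>Openness is local: around each point, a coordinate ball on which the immersion is
  injective has a relatively open image by \<open>openin_model_image\<close>.\<close>

theorem open_in_model:
  "\<exists>Dl R. dilation Dl \<and> rigid_motion R \<and>
    openin (top_of_set model_soliton) (R ` Dl ` \<phi> ` topspace M)"
proof -
  obtain Dl R where DR: "dilation Dl" "rigid_motion R"
    and cont: "continuous_on UNIV (R \<circ> Dl)" and injRD: "inj (R \<circ> Dl)"
    and mod: "\<And>c u. c \<in> \<A> \<Longrightarrow> u \<in> coords c \<Longrightarrow> R (Dl (local_param \<phi> c u)) \<in> model_soliton"
    using image_in_model by blast
  have "openin (top_of_set model_soliton) (R ` Dl ` \<phi> ` topspace M)"
  proof (subst openin_subopen, intro ballI)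
    fix y assume "y \<in> R ` Dl ` \<phi> ` topspace M"
    then obtain m where m: "m \<in> topspace M" "y = R (Dl (\<phi> m))" by blast
    obtain c where c: "c \<in> \<A>" "m \<in> fst c" using covered[OF m(1)] by blast
    have u: "snd c m \<in> coords c" by (rule chart_mem[OF c(2)])
    interpret soliton_param "local_param \<phi> c" "coords c" e by (rule param[OF c(1)])
    obtain r where r: "r > 0" "ball (snd c m) r \<subseteq> coords c" "inj_on (local_param \<phi> c) (ball (snd c m) r)"
      using locally_injective[OF u] .
    let ?F = "(R \<circ> Dl) \<circ> local_param \<phi> c" and ?B = "ball (snd c m) r"
    have "openin (top_of_set model_soliton) (?F ` ?B)"
    proof (rule openin_model_image)
      show "open ?B" by simp
      have "continuous_on ?B (local_param \<phi> c)"
        using smooth_on_continuous_on[OF smooth] r(2) continuous_on_subset by blast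
      then show "continuous_on ?B ?F"
        by (rule continuous_on_compose[OF _ continuous_on_subset[OF cont subset_UNIV]])
      show "inj_on ?F ?B" by (rule comp_inj_on[OF r(3) inj_on_subset[OF injRD subset_UNIV]])
      show "?F ` ?B \<subseteq> model_soliton" using mod[OF c(1)] r(2) by auto
    qed
    moreover have "y \<in> ?F ` ?B"
      using r(1) m(2) local_param_chart[OF c] by (auto intro!: image_eqI[of _ _ "snd c m"])
    moreover have "?F ` ?B \<subseteq> R ` Dl ` \<phi> ` topspace M"
    proof
      fix z assume "z \<in> ?F ` ?B"
      then obtain x where x: "x \<in> ?B" "z = R (Dl (local_param \<phi> c x))" by auto
      then obtain m' where m': "m' \<in> fst c" "x = snd c m'" using r(2) by (auto simp: coords_def)
      have "m' \<in> topspace M" using m' openin_subset[OF chart(1)[OF c(1)]] by blast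
      then show "z \<in> R ` Dl ` \<phi> ` topspace M" using x m' local_param_chart[OF c(1) m'(1)] by auto
    qed
    ultimately show "\<exists>T. openin (top_of_set model_soliton) T \<and> y \<in> T \<and> T \<subseteq> R ` Dl ` \<phi> ` topspace M"
      by blast
  qed
  with DR show ?thesis by blast
qed

end

theorem corollary3:
  fixes M :: "'a topology"
    and \<A> :: "'a chart set"
    and \<phi> :: "'a \<Rightarrow> complex \<times> complex"
  assumes "connected_smooth_surface M \<A>"
    and "immersion \<A> \<phi>"
    and "lagrangian \<A> \<phi>"
    and "hamiltonian_stationary \<A> \<phi>"
    and "\<not> totally_geodesic \<A> \<phi>"
    and "translating_soliton \<A> \<phi>"
  shows "\<exists>D R. dilation D \<and> rigid_motion R \<and>
    openin (top_of_set model_soliton) (R ` D ` \<phi> ` topspace M)"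
proof -
  obtain e where e: "e \<noteq> 0" "\<And>c u. c \<in> \<A> \<Longrightarrow> u \<in> coords c \<Longrightarrow>
      mean_curvature (local_param \<phi> c) u = normal_part (local_param \<phi> c) u e"
    using assms(6) unfolding translating_soliton_def by blast
  interpret soliton_surface M \<A> \<phi> e
    by unfold_locales (use assms e in auto)
  show ?thesis by (rule open_in_model)
qed

end
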